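(* Let $0\le\varepsilon\le\varepsilon_0$ and $f\in L^2(\Omega)$. The following two variational problems, each posed for $u,w\in H_0^1(\Omega)$, $\boldsymbol\phi\in V$, $\boldsymbol p\in Q$, $r\in R$, are equivalent, i.e. $(u,w,\boldsymbol\phi,\boldsymbol p,r)$ solves one if and only if it solves the other. (A) For all $v,\xi\in H_0^1(\Omega)$, $\boldsymbol\psi\in V$, $\boldsymbol q\in Q$, $s\in R$: $$(\nabla w,\nabla v)=(f,v),\qquad B_1(\boldsymbol\phi,r,\boldsymbol p;\boldsymbol\psi,s,\boldsymbol q)=(\nabla w,\boldsymbol\psi),\qquad(\nabla u,\nabla\xi)=(\boldsymbol\phi,\nabla\xi).$$ (B) For all $v,\xi\in H_0^1(\Omega)$, $\boldsymbol\psi\in V$, $\boldsymbol q\in Q$, $s\in R$: $$(\nabla w,\nabla v)=(f,v),\qquad B_1(\boldsymbol\phi,r,\boldsymbol p;\boldsymbol\psi,s,\boldsymbol q)+(r,s)=(\nabla w,\boldsymbol\psi),\qquad(\nabla u,\nabla\xi)=(\boldsymbol\phi,\nabla\xi).$$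
   Context: Let $\Omega\subset\mathbb R^3$ be a bounded polyhedral domain; $(\cdot,\cdot)$ is the $L^2(\Omega)$ inner product (scalar or vector). Fix $\varepsilon_0>0$ and let $0\le\varepsilon\le\varepsilon_0$. $V=H_0^1(\Omega;\mathbb R^3)$ if $\varepsilon>0$ and $V=L^2(\Omega;\mathbb R^3)$ if $\varepsilon=0$; $R=L_0^2(\Omega)$ (mean-zero $L^2$ functions); $Q=H_0(\mathrm{div};\Omega)$ (fields in $H(\mathrm{div};\Omega)$ with vanishing normal trace) if $\varepsilon>0$ and $Q=H_0(\mathrm{div};\Omega)\cap H(\mathrm{curl};\Omega)$ if $\varepsilon=0$. The pairing $\langle\boldsymbol\psi,\operatorname{curl}\boldsymbol q\rangle$ for $(\boldsymbol\psi,\boldsymbol q)\in V\times Q$ equals $(\operatorname{curl}\boldsymbol\psi,\boldsymbol q)$ if $\varepsilon>0$ and $(\boldsymbol\psi,\operatorname{curl}\boldsymbol q)$ if $\varepsilon=0$. The bilinear form $B_1$ is (the term with factor $\varepsilon^2$ being absent if $\varepsilon=0$) $$B_1(\boldsymbol\phi,r,\boldsymbol p;\boldsymbol\psi,s,\boldsymbol q)=\varepsilon^2(\nabla\boldsymbol\phi,\nabla\boldsymbol\psi)+(\boldsymbol\phi,\boldsymbol\psi)+\langle\boldsymbol\phi,\operatorname{curl}\boldsymbol q\rangle+(r,\operatorname{div}\boldsymbol q)+\langle\boldsymbol\psi,\operatorname{curl}\boldsymbol p\rangle+(s,\operatorname{div}\boldsymbol p).$$ *)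

theory Defs
  imports "HOL-Analysis.Analysis"
begin

type_synonym scalar_field = "real^3 \<Rightarrow> real"
type_synonym vector_field = "real^3 \<Rightarrow> real^3"

text \<open>A polygon is a finite union of convex polygons, so it is enough to let the boundary be a
  finite union of two-dimensional polytopes. The domain may be non-convex, non-Lipschitz or
  multiply connected, and its boundary may be disconnected.\<close>

definition polyhedral_domain :: "(real^3) set \<Rightarrow> bool" where
  "polyhedral_domain \<Omega> \<longleftrightarrow>
     open \<Omega> \<and> connected \<Omega> \<and> \<Omega> \<noteq> {} \<and> bounded \<Omega> \<and>
     (\<exists>P. finite P \<and> (\<forall>F\<in>P. polytope F \<and> aff_dim F = 2) \<and> frontier \<Omega> = \<Union>P)"


subsection \<open>Square integrable fields\<close>

text \<open>Elements of Lebesgue and Sobolev spaces are represented by functions on the whole space;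
  values outside \<open>\<Omega>\<close> and on null sets play no role in what follows.\<close>

definition L2 :: "(real^3) set \<Rightarrow> (real^3 \<Rightarrow> 'b::euclidean_space) set" where
  "L2 \<Omega> = {f. f \<in> borel_measurable (lebesgue_on \<Omega>) \<and>
               integrable (lebesgue_on \<Omega>) (\<lambda>x. (norm (f x))\<^sup>2)}"

definition l2_inner :: "(real^3) set \<Rightarrow> (real^3 \<Rightarrow> 'b::euclidean_space) \<Rightarrow> (real^3 \<Rightarrow> 'b) \<Rightarrow> real" where
  "l2_inner \<Omega> f g = (LINT x|lebesgue_on \<Omega>. f x \<bullet> g x)"

definition L2_mean_zero :: "(real^3) set \<Rightarrow> scalar_field set" where
  "L2_mean_zero \<Omega> = {r \<in> L2 \<Omega>. (LINT x|lebesgue_on \<Omega>. r x) = 0}"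


subsection \<open>Test functions and their classical derivatives\<close>

definition partial :: "3 \<Rightarrow> scalar_field \<Rightarrow> scalar_field" where
  "partial i f x = frechet_derivative f (at x) (axis i 1)"

text \<open>All iterated partial derivatives exist and are differentiable, hence continuous.\<close>

definition smooth :: "scalar_field \<Rightarrow> bool" where
  "smooth f \<longleftrightarrow> (\<forall>is x. foldr partial is f differentiable (at x))"

definition test_fun :: "(real^3) set \<Rightarrow> scalar_field \<Rightarrow> bool" where
  "test_fun \<Omega> \<theta> \<longleftrightarrow>
     smooth \<theta> \<and> compact (closure {x. \<theta> x \<noteq> 0}) \<and> closure {x. \<theta> x \<noteq> 0} \<subseteq> \<Omega>"

definition test_field :: "(real^3) set \<Rightarrow> vector_field \<Rightarrow> bool" where
  "test_field \<Omega> \<theta> \<longleftrightarrow> (\<forall>i. test_fun \<Omega> (\<lambda>x. \<theta> x $ i))"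

definition classical_grad :: "scalar_field \<Rightarrow> vector_field" where
  "classical_grad \<theta> x = (\<chi> i. partial i \<theta> x)"

definition classical_div :: "vector_field \<Rightarrow> scalar_field" where
  "classical_div \<theta> x = (\<Sum>i\<in>UNIV. partial i (\<lambda>y. \<theta> y $ i) x)"

definition classical_curl :: "vector_field \<Rightarrow> vector_field" where
  "classical_curl \<theta> x = vector
     [partial 2 (\<lambda>y. \<theta> y $ 3) x - partial 3 (\<lambda>y. \<theta> y $ 2) x,
      partial 3 (\<lambda>y. \<theta> y $ 1) x - partial 1 (\<lambda>y. \<theta> y $ 3) x,
      partial 1 (\<lambda>y. \<theta> y $ 2) x - partial 2 (\<lambda>y. \<theta> y $ 1) x]"


subsection \<open>Distributional derivatives in \<open>L\<^sup>2\<close>\<close>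

definition is_weak_grad :: "(real^3) set \<Rightarrow> scalar_field \<Rightarrow> vector_field \<Rightarrow> bool" where
  "is_weak_grad \<Omega> v g \<longleftrightarrow> g \<in> L2 \<Omega> \<and>
     (\<forall>\<theta>. test_field \<Omega> \<theta> \<longrightarrow> l2_inner \<Omega> g \<theta> = - l2_inner \<Omega> v (classical_div \<theta>))"

definition is_weak_div :: "(real^3) set \<Rightarrow> vector_field \<Rightarrow> scalar_field \<Rightarrow> bool" where
  "is_weak_div \<Omega> q g \<longleftrightarrow> g \<in> L2 \<Omega> \<and>
     (\<forall>\<theta>. test_fun \<Omega> \<theta> \<longrightarrow> l2_inner \<Omega> g \<theta> = - l2_inner \<Omega> q (classical_grad \<theta>))"

definition is_weak_curl :: "(real^3) set \<Rightarrow> vector_field \<Rightarrow> vector_field \<Rightarrow> bool" where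
  "is_weak_curl \<Omega> q g \<longleftrightarrow> g \<in> L2 \<Omega> \<and>
     (\<forall>\<theta>. test_field \<Omega> \<theta> \<longrightarrow> l2_inner \<Omega> g \<theta> = l2_inner \<Omega> q (classical_curl \<theta>))"

text \<open>The distributional derivatives are unique up to null sets; \<open>SOME\<close> picks a representative.
  It is meaningful only for arguments that possess the derivative.\<close>

definition weak_grad :: "(real^3) set \<Rightarrow> scalar_field \<Rightarrow> vector_field" where
  "weak_grad \<Omega> v = (SOME g. is_weak_grad \<Omega> v g)"

definition weak_div :: "(real^3) set \<Rightarrow> vector_field \<Rightarrow> scalar_field" where
  "weak_div \<Omega> q = (SOME g. is_weak_div \<Omega> q g)"

definition weak_curl :: "(real^3) set \<Rightarrow> vector_field \<Rightarrow> vector_field" where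
  "weak_curl \<Omega> q = (SOME g. is_weak_curl \<Omega> q g)"

text \<open>Row \<open>i\<close> is the gradient of component \<open>i\<close>; the inner product of \<open>real^3^3\<close> is the
  Frobenius product.\<close>

definition weak_jacobian :: "(real^3) set \<Rightarrow> vector_field \<Rightarrow> real^3 \<Rightarrow> real^3^3" where
  "weak_jacobian \<Omega> \<phi> x = (\<chi> i. weak_grad \<Omega> (\<lambda>y. \<phi> y $ i) x)"


subsection \<open>Sobolev spaces\<close>

definition H1 :: "(real^3) set \<Rightarrow> scalar_field set" where
  "H1 \<Omega> = {v \<in> L2 \<Omega>. \<exists>g. is_weak_grad \<Omega> v g}"

definition H1_norm :: "(real^3) set \<Rightarrow> scalar_field \<Rightarrow> real" where
  "H1_norm \<Omega> v = sqrt (l2_inner \<Omega> v v + l2_inner \<Omega> (weak_grad \<Omega> v) (weak_grad \<Omega> v))"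

text \<open>The closure of the test functions in \<open>H\<^sup>1(\<Omega>)\<close>.\<close>

definition H10 :: "(real^3) set \<Rightarrow> scalar_field set" where
  "H10 \<Omega> = {v \<in> H1 \<Omega>. \<forall>e>0. \<exists>\<theta>. test_fun \<Omega> \<theta> \<and> H1_norm \<Omega> (\<lambda>x. v x - \<theta> x) < e}"

definition H10_vec :: "(real^3) set \<Rightarrow> vector_field set" where
  "H10_vec \<Omega> = {\<phi>. \<forall>i. (\<lambda>x. \<phi> x $ i) \<in> H10 \<Omega>}"

definition Hdiv :: "(real^3) set \<Rightarrow> vector_field set" where
  "Hdiv \<Omega> = {q \<in> L2 \<Omega>. \<exists>g. is_weak_div \<Omega> q g}"

definition Hcurl :: "(real^3) set \<Rightarrow> vector_field set" where
  "Hcurl \<Omega> = {q \<in> L2 \<Omega>. \<exists>g. is_weak_curl \<Omega> q g}"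

text \<open>The normal trace of \<open>q \<in> H(div; \<Omega>)\<close> is the functional on \<open>H\<^sup>1(\<Omega>)\<close> given by Green's formula.
  It depends only on the boundary values of its argument; for Lipschitz domains it is the usual
  element of the dual of \<open>H\<^bsup>1/2\<^esup>(\<partial>\<Omega>)\<close>.\<close>

definition normal_trace :: "(real^3) set \<Rightarrow> vector_field \<Rightarrow> scalar_field \<Rightarrow> real" where
  "normal_trace \<Omega> q v = l2_inner \<Omega> q (weak_grad \<Omega> v) + l2_inner \<Omega> (weak_div \<Omega> q) v"

definition H0div :: "(real^3) set \<Rightarrow> vector_field set" where
  "H0div \<Omega> = {q \<in> Hdiv \<Omega>. \<forall>v\<in>H1 \<Omega>. normal_trace \<Omega> q v = 0}"


subsection \<open>The variational problems\<close>

definition V_space :: "(real^3) set \<Rightarrow> real \<Rightarrow> vector_field set" where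
  "V_space \<Omega> \<epsilon> = (if \<epsilon> > 0 then H10_vec \<Omega> else L2 \<Omega>)"

definition Q_space :: "(real^3) set \<Rightarrow> real \<Rightarrow> vector_field set" where
  "Q_space \<Omega> \<epsilon> = (if \<epsilon> > 0 then H0div \<Omega> else H0div \<Omega> \<inter> Hcurl \<Omega>)"

definition curl_pairing :: "(real^3) set \<Rightarrow> real \<Rightarrow> vector_field \<Rightarrow> vector_field \<Rightarrow> real" where
  "curl_pairing \<Omega> \<epsilon> \<psi> q =
     (if \<epsilon> > 0 then l2_inner \<Omega> (weak_curl \<Omega> \<psi>) q else l2_inner \<Omega> \<psi> (weak_curl \<Omega> q))"

definition B1 :: "(real^3) set \<Rightarrow> real \<Rightarrow> vector_field \<Rightarrow> scalar_field \<Rightarrow> vector_field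
    \<Rightarrow> vector_field \<Rightarrow> scalar_field \<Rightarrow> vector_field \<Rightarrow> real" where
  "B1 \<Omega> \<epsilon> \<phi> r p \<psi> s q =
     (if \<epsilon> > 0 then \<epsilon>\<^sup>2 * l2_inner \<Omega> (weak_jacobian \<Omega> \<phi>) (weak_jacobian \<Omega> \<psi>) else 0)
     + l2_inner \<Omega> \<phi> \<psi>
     + curl_pairing \<Omega> \<epsilon> \<phi> q + l2_inner \<Omega> r (weak_div \<Omega> q)
     + curl_pairing \<Omega> \<epsilon> \<psi> p + l2_inner \<Omega> s (weak_div \<Omega> p)"

definition solves_A :: "(real^3) set \<Rightarrow> real \<Rightarrow> scalar_field \<Rightarrow> scalar_field \<Rightarrow> scalar_field
    \<Rightarrow> vector_field \<Rightarrow> vector_field \<Rightarrow> scalar_field \<Rightarrow> bool" where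
  "solves_A \<Omega> \<epsilon> f u w \<phi> p r \<longleftrightarrow>
     (\<forall>v\<in>H10 \<Omega>. \<forall>\<xi>\<in>H10 \<Omega>. \<forall>\<psi>\<in>V_space \<Omega> \<epsilon>. \<forall>q\<in>Q_space \<Omega> \<epsilon>. \<forall>s\<in>L2_mean_zero \<Omega>.
        l2_inner \<Omega> (weak_grad \<Omega> w) (weak_grad \<Omega> v) = l2_inner \<Omega> f v \<and>
        B1 \<Omega> \<epsilon> \<phi> r p \<psi> s q = l2_inner \<Omega> (weak_grad \<Omega> w) \<psi> \<and>
        l2_inner \<Omega> (weak_grad \<Omega> u) (weak_grad \<Omega> \<xi>) = l2_inner \<Omega> \<phi> (weak_grad \<Omega> \<xi>))"

definition solves_B :: "(real^3) set \<Rightarrow> real \<Rightarrow> scalar_field \<Rightarrow> scalar_field \<Rightarrow> scalar_field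
    \<Rightarrow> vector_field \<Rightarrow> vector_field \<Rightarrow> scalar_field \<Rightarrow> bool" where
  "solves_B \<Omega> \<epsilon> f u w \<phi> p r \<longleftrightarrow>
     (\<forall>v\<in>H10 \<Omega>. \<forall>\<xi>\<in>H10 \<Omega>. \<forall>\<psi>\<in>V_space \<Omega> \<epsilon>. \<forall>q\<in>Q_space \<Omega> \<epsilon>. \<forall>s\<in>L2_mean_zero \<Omega>.
        l2_inner \<Omega> (weak_grad \<Omega> w) (weak_grad \<Omega> v) = l2_inner \<Omega> f v \<and>
        B1 \<Omega> \<epsilon> \<phi> r p \<psi> s q + l2_inner \<Omega> r s = l2_inner \<Omega> (weak_grad \<Omega> w) \<psi> \<and>
        l2_inner \<Omega> (weak_grad \<Omega> u) (weak_grad \<Omega> \<xi>) = l2_inner \<Omega> \<phi> (weak_grad \<Omega> \<xi>))"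

end

theory Submission
  imports Defs
begin

text \<open>
  The two problems differ only by the term \<open>(r, s)\<close>, so it is enough to see that \<open>r\<close> vanishes
  almost everywhere as soon as either problem holds. Comparing the second equation for a field
  \<open>q\<close> with the same equation for \<open>q = 0\<close>, the other test functions being kept, leaves in both cases
  \<open>\<langle>\<phi>, curl q\<rangle> + (r, div q) = 0\<close> for all \<open>q \<in> Q\<close>.

  Formally one would take \<open>q = grad z\<close> with \<open>div q = r\<close> and vanishing normal trace: gradients are
  invisible to the curl pairing (\<open>curl_pairing_grad\<close>; for \<open>\<epsilon> > 0\<close> this uses the density of test
  fields in \<open>V\<close>), whence \<open>(r, r) = 0\<close>. This is a pure Neumann problem, whose solvability rests on
  a Poincare inequality, which is awkward for a domain that need not be Lipschitz. The
  equation \<open>- div grad z + z = r\<close> with Neumann condition serves as well and is solvable on every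
  bounded open set: \<open>(z, grad z)\<close> is the orthogonal projection of \<open>(r, 0)\<close> to the graph of
  the weak gradient, a closed subspace of \<open>L\<^sup>2\<close> (\<open>neumann_problem\<close>). Now \<open>div q = z - r\<close>, so
  the identity above says \<open>(r, z) = (r, r)\<close>; together with the weak equation tested with
  \<open>z\<close> itself this gives \<open>(r - z, r - z) + (q, q) = 0\<close>. Therefore \<open>r = z\<close> and
  \<open>grad r = 0\<close>, so \<open>r\<close> is constant on the connected set \<open>\<Omega>\<close> (\<open>weakly_constant\<close>), and its
  mean value is zero (\<open>multiplier_vanishes\<close>).

  The remaining lemmas supply the analysis behind this: bump functions and the fundamental lemma of
  the calculus of variations, which makes weak derivatives unique up to null sets; completeness
  of \<open>L\<^sup>2\<close> and orthogonal projections (\<open>L2_complete\<close>, \<open>L2_projection\<close>); integration by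
  parts for test functions; and the symmetry of second derivatives, which gives
  \<open>div curl = 0\<close>.
\<close>

section \<open>Smooth functions\<close>

lemma smooth_differentiable: "smooth f \<Longrightarrow> f differentiable (at x)"
  unfolding smooth_def by (metis foldr_Nil id_apply)

lemma smooth_partial: "smooth f \<Longrightarrow> smooth (partial i f)"
  unfolding smooth_def
proof (intro allI)
  fix js x assume "\<forall>is x. foldr partial is f differentiable at x"
  then have "foldr partial (js @ [i]) f differentiable at x" by blast
  then show "foldr partial js (partial i f) differentiable at x" by simp
qed

text \<open>This replaces induction over iterated derivatives: it suffices to exhibit a set of functions that
  is stable under partial derivatives.\<close>

lemma smooth_coinduct:
  assumes "f \<in> C" and "\<And>g x. g \<in> C \<Longrightarrow> g differentiable (at x)"
    and "\<And>g i. g \<in> C \<Longrightarrow> partial i g \<in> C"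
  shows "smooth f"
proof -
  have "foldr partial is f \<in> C" for "is"
    by (induction "is") (use assms in auto)
  then show ?thesis
    unfolding smooth_def using assms(2) by blast
qed

lemma smoothI:
  assumes "\<And>x. f differentiable (at x)" and "\<And>i. smooth (partial i f)"
  shows "smooth f"
  by (rule smooth_coinduct[of f "insert f (Collect smooth)"])
     (use assms smooth_differentiable smooth_partial in auto)

lemma smooth_isCont: "smooth f \<Longrightarrow> isCont f x"
  by (simp add: differentiable_imp_continuous_within smooth_differentiable)

lemma smooth_continuous_on: "smooth f \<Longrightarrow> continuous_on S f"
  using continuous_at_imp_continuous_on smooth_isCont by blast

lemma partial_eqI: "(f has_derivative f') (at x) \<Longrightarrow> partial i f x = f' (axis i 1)"
  unfolding partial_def using frechet_derivative_at by force

lemma has_derivative_frechet: "f differentiable (at x) \<Longrightarrow> (f has_derivative frechet_derivative f (at x)) (at x)"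
  using frechet_derivative_works by blast

lemma partial_const [simp]: "partial i (\<lambda>x. c) = (\<lambda>x. 0)"
  by (rule ext, rule partial_eqI[where f' = "\<lambda>_. 0"]) simp

lemma partial_add:
  assumes "f differentiable (at x)" "g differentiable (at x)"
  shows "partial i (\<lambda>x. f x + g x) x = partial i f x + partial i g x"
  by (rule trans[OF partial_eqI[OF has_derivative_add[OF assms[THEN has_derivative_frechet]]]])
     (simp add: partial_def)

lemma partial_mult:
  assumes "f differentiable (at x)" "g differentiable (at x)"
  shows "partial i (\<lambda>x. f x * g x) x = f x * partial i g x + partial i f x * g x"
  by (rule trans[OF partial_eqI[OF has_derivative_mult[OF assms[THEN has_derivative_frechet]]]])
     (simp add: partial_def)

lemma partial_diff:
  assumes "f differentiable (at x)" "g differentiable (at x)"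
  shows "partial i (\<lambda>x. f x - g x) x = partial i f x - partial i g x"
  by (rule trans[OF partial_eqI[OF has_derivative_diff[OF assms[THEN has_derivative_frechet]]]])
     (simp add: partial_def)

lemma smooth_const: "smooth (\<lambda>x. c)"
  by (rule smooth_coinduct[of _ "range (\<lambda>c x. c)"]) auto

text \<open>The Leibniz rule turns a derivative of a product into a sum of products, so neither products
  alone nor sums alone are closed under partial derivatives; the ring generated by the smooth
  functions is.\<close>

inductive_set smooth_ring :: "scalar_field set" where
  base: "smooth f \<Longrightarrow> f \<in> smooth_ring"
| add: "f \<in> smooth_ring \<Longrightarrow> g \<in> smooth_ring \<Longrightarrow> (\<lambda>x. f x + g x) \<in> smooth_ring"
| mult: "f \<in> smooth_ring \<Longrightarrow> g \<in> smooth_ring \<Longrightarrow> (\<lambda>x. f x * g x) \<in> smooth_ring"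

lemma smooth_ring_differentiable: "f \<in> smooth_ring \<Longrightarrow> f differentiable (at x)"
  by (induction rule: smooth_ring.induct)
     (auto intro: smooth_differentiable differentiable_add differentiable_mult)

lemma smooth_ring_partial: "f \<in> smooth_ring \<Longrightarrow> partial i f \<in> smooth_ring"
proof (induction rule: smooth_ring.induct)
  case (base f)
  then show ?case by (simp add: smooth_partial smooth_ring.base)
next
  case (add f g)
  have "partial i (\<lambda>x. f x + g x) = (\<lambda>x. partial i f x + partial i g x)"
    using add by (intro ext partial_add smooth_ring_differentiable)
  then show ?case using add by (simp add: smooth_ring.add)
next
  case (mult f g)
  have "partial i (\<lambda>x. f x * g x) = (\<lambda>x. f x * partial i g x + partial i f x * g x)"
    using mult by (intro ext partial_mult smooth_ring_differentiable)
  then show ?case using mult by (simp add: smooth_ring.intros)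
qed

lemma smooth_ring_smooth: "f \<in> smooth_ring \<Longrightarrow> smooth f"
  using smooth_coinduct smooth_ring_differentiable smooth_ring_partial by blast

lemma smooth_add: "smooth f \<Longrightarrow> smooth g \<Longrightarrow> smooth (\<lambda>x. f x + g x)"
  by (simp add: smooth_ring.intros smooth_ring_smooth)

lemma smooth_mult: "smooth f \<Longrightarrow> smooth g \<Longrightarrow> smooth (\<lambda>x. f x * g x)"
  by (simp add: smooth_ring.intros smooth_ring_smooth)

lemma smooth_uminus: "smooth f \<Longrightarrow> smooth (\<lambda>x. - f x)"
  using smooth_mult[OF smooth_const[of "-1"], of f] by simp

lemma smooth_diff: "smooth f \<Longrightarrow> smooth g \<Longrightarrow> smooth (\<lambda>x. f x - g x)"
  using smooth_add[OF _ smooth_uminus, of f g] by simp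

lemma smooth_prod: "finite I \<Longrightarrow> (\<And>i. i \<in> I \<Longrightarrow> smooth (f i)) \<Longrightarrow> smooth (\<lambda>x. \<Prod>i\<in>I. f i x)"
  by (induction I rule: finite_induct) (auto intro: smooth_const smooth_mult)

subsection \<open>Functions of one coordinate\<close>

lemma partial_along_line:
  assumes "\<And>x. f differentiable (at x)"
  shows "((\<lambda>s. f (x + s *\<^sub>R axis i 1)) has_real_derivative partial i f (x + s *\<^sub>R axis i 1)) (at s)"
proof -
  let ?y = "x + s *\<^sub>R axis i 1"
  have "((\<lambda>s. x + s *\<^sub>R axis i 1) has_derivative (\<lambda>v. v *\<^sub>R axis i 1)) (at s)"
    by (auto intro!: derivative_eq_intros)
  then have D: "((\<lambda>s. f (x + s *\<^sub>R axis i 1)) has_derivative (\<lambda>v. frechet_derivative f (at ?y) (v *\<^sub>R axis i 1))) (at s)"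
    using has_derivative_compose[OF _ has_derivative_frechet[OF assms]] by blast
  have "linear (frechet_derivative f (at ?y))"
    using has_derivative_frechet[OF assms] has_derivative_linear by blast
  then have "(\<lambda>v. frechet_derivative f (at ?y) (v *\<^sub>R axis i 1)) = (*) (partial i f ?y)"
    by (auto simp: partial_def linear_cmul mult.commute)
  then show ?thesis
    using D by (simp add: has_field_derivative_def)
qed

lemma partial_eq_0:
  assumes "\<And>x. f differentiable (at x)" and "\<And>x s. f (x + s *\<^sub>R axis i 1) = f x"
  shows "partial i f x = 0"
proof -
  have "((\<lambda>s. f x) has_real_derivative partial i f x) (at 0)"
    using partial_along_line[OF assms(1), of x i 0] assms(2) by simp
  then show ?thesis using DERIV_unique DERIV_const by blast
qed

lemma has_derivative_coord:
  fixes h :: "real \<Rightarrow> real"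
  assumes "(h has_real_derivative d) (at (x $ j))"
  shows "((\<lambda>x::real^3. h (x $ j)) has_derivative (\<lambda>v. d * v $ j)) (at x)"
  using has_derivative_compose[OF bounded_linear.has_derivative[OF bounded_linear_vec_nth has_derivative_ident, of j]
      assms[unfolded has_field_derivative_def]]
  by simp

lemma partial_coord:
  assumes "\<And>t. (h has_real_derivative h' t) (at t)"
  shows "partial i (\<lambda>x. h (x $ j)) = (\<lambda>x. if i = j then h' (x $ j) else 0)"
  by (rule ext, subst partial_eqI[OF has_derivative_coord[OF assms]]) (auto simp: axis_def)

lemma smooth_coord_antiderivative:
  assumes "\<And>t. (h has_real_derivative h' t) (at t)" and "smooth (\<lambda>x. h' (x $ j))"
  shows "smooth (\<lambda>x. h (x $ j))"
proof (rule smoothI)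
  show "(\<lambda>x. h (x $ j)) differentiable at x" for x
    using has_derivative_coord[OF assms(1)] differentiableI by blast
  show "smooth (partial i (\<lambda>x. h (x $ j)))" for i
    unfolding partial_coord[OF assms(1)] by (cases "i = j") (use assms(2) smooth_const in auto)
qed

text \<open>The derivatives of \<open>exp (- 1 / t)\<close>, extended by zero to \<open>t \<le> 0\<close>, are of this form.\<close>

definition flat :: "real poly \<Rightarrow> real \<Rightarrow> real" where
  "flat P t = (if t > 0 then poly P (1 / t) * exp (- (1 / t)) else 0)"

lemma poly_exp_tendsto_0: "((\<lambda>s. s ^ k * poly P s * exp (- s)) \<longlongrightarrow> (0::real)) at_top"
proof (induction P arbitrary: k rule: pCons_induct)
  case 0
  then show ?case by simp
next
  case (pCons a P)
  have "((\<lambda>s. a * (s ^ k / exp s) + s ^ Suc k * poly P s * exp (- s)) \<longlongrightarrow> a * 0 + 0) at_top"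
    by (intro tendsto_intros tendsto_power_div_exp_0 pCons.IH)
  then show ?case
    by (simp add: algebra_simps exp_minus divide_inverse)
qed

lemma flat_tendsto_0: "((\<lambda>t. flat P t) \<longlongrightarrow> 0) (at 0)"
proof -
  have "((\<lambda>t. poly P (inverse t) * exp (- inverse t)) \<longlongrightarrow> 0) (at_right 0)"
    using filterlim_compose[OF poly_exp_tendsto_0[of 0 P] filterlim_inverse_at_top_right] by simp
  then have "(flat P \<longlongrightarrow> 0) (at_right 0)"
    by (rule Lim_transform_eventually)
       (use eventually_at_right_less[of "0::real"] in eventually_elim,
        auto simp: flat_def inverse_eq_divide)
  moreover have "(flat P \<longlongrightarrow> 0) (at_left 0)"
    by (rule tendsto_eventually) (auto simp: flat_def eventually_at_filter intro!: always_eventually)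
  ultimately show ?thesis by (simp add: filterlim_split_at)
qed

text \<open>At zero the difference quotient is again a flat function, with the polynomial multiplied by its
  variable, and therefore tends to zero.\<close>

lemma flat_has_derivative:
  "(flat P has_real_derivative flat ((P - pderiv P) * [:0, 0, 1:]) t) (at t)"
proof -
  consider "t > 0" | "t = 0" | "t < 0" by linarith
  then show ?thesis
  proof cases
    case 1
    have "((\<lambda>t. poly P (1 / t) * exp (- (1 / t))) has_real_derivative
        flat ((P - pderiv P) * [:0, 0, 1:]) t) (at t)"
      using 1 by (auto intro!: derivative_eq_intros poly_DERIV[THEN DERIV_chain2] simp: flat_def field_simps power2_eq_square)
    then show ?thesis
      by (rule has_field_derivative_transform_within_open[where S = "{0<..}"])
         (use 1 in \<open>auto simp: flat_def\<close>)
  next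
    case 2
    have "((\<lambda>s. flat P s / s) \<longlongrightarrow> 0) (at 0)"
    proof (rule Lim_transform_eventually[OF flat_tendsto_0[of "[:0, 1:] * P"]])
      show "\<forall>\<^sub>F s in at 0. flat ([:0, 1:] * P) s = flat P s / s"
        by (auto simp: flat_def)
    qed
    then show ?thesis
      using 2 by (auto simp: has_field_derivative_iff flat_def)
  next
    case 3
    show ?thesis
      by (rule has_field_derivative_transform_within_open[where S = "{..<0}" and f = "\<lambda>_. 0"])
         (use 3 in \<open>auto simp: flat_def\<close>)
  qed
qed

lemma smooth_flat: "smooth (\<lambda>x. flat P (m * x $ j + c))"
proof -
  have D: "((\<lambda>t. a * flat P (m * t + c)) has_real_derivative
      (a * m) * flat ((P - pderiv P) * [:0, 0, 1:]) (m * t + c)) (at t)" for a P t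
    by (auto intro!: derivative_eq_intros flat_has_derivative[THEN DERIV_chain2])
  let ?C = "{(\<lambda>x. a * flat P (m * x $ j + c)) | a P. True}"
  have *: "(\<lambda>x. 1 * flat P (m * x $ j + c)) \<in> ?C" by blast
  have "smooth (\<lambda>x. 1 * flat P (m * x $ j + c))"
  proof (rule smooth_coinduct[OF *])
    fix g i x assume "g \<in> ?C"
    then obtain a P where g: "g = (\<lambda>x. a * flat P (m * x $ j + c))" by auto
    show "g differentiable at x"
      unfolding g using has_derivative_coord[OF D] differentiableI by blast
    show "partial i g \<in> ?C"
    proof (cases "i = j")
      case True
      then show ?thesis unfolding g partial_coord[OF D] by auto
    next
      case False
      then show ?thesis unfolding g partial_coord[OF D] by (auto intro: exI[of _ 0])
    qed
  qed
  then show ?thesis by simp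
qed

text \<open>With \<open>n\<close> the plateau widens: \<open>exp (- 1 / (n s))\<close> increases to 1 for every \<open>s > 0\<close>. The bumps
  thus approximate the indicator of the interval without leaving it.\<close>

definition bump :: "real \<Rightarrow> real \<Rightarrow> nat \<Rightarrow> real \<Rightarrow> real" where
  "bump l u n t = flat 1 (real (Suc n) * (t - l)) * flat 1 (real (Suc n) * (u - t))"

lemma smooth_bump: "smooth (\<lambda>x. bump l u n (x $ j))"
proof -
  have eq: "(\<lambda>x::real^3. bump l u n (x $ j)) =
     (\<lambda>x. flat 1 (real (Suc n) * x $ j + - (real (Suc n) * l)) *
          flat 1 (- real (Suc n) * x $ j + real (Suc n) * u))"
    unfolding bump_def by (rule ext) (simp add: algebra_simps)
  show ?thesis
    unfolding eq by (intro smooth_mult smooth_flat)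
qed

lemma bump_bounds: "0 \<le> bump l u n t" "bump l u n t \<le> 1"
  by (auto simp: bump_def flat_def intro!: mult_le_one)

lemma bump_eq_0_iff: "bump l u n t = 0 \<longleftrightarrow> t \<notin> {l<..<u}"
  by (auto simp: bump_def flat_def zero_less_mult_iff)

lemma bump_tendsto: "(\<lambda>n. bump l u n t) \<longlonglongrightarrow> indicator {l<..<u} t"
proof (cases "t \<in> {l<..<u}")
  case True
  have *: "(\<lambda>n. exp (- (1 / (real (Suc n) * c)))) \<longlonglongrightarrow> exp (- (0 / c))" if "c > 0" for c :: real
  proof -
    have "(\<lambda>n. exp (- (inverse (real (Suc n)) / c))) \<longlonglongrightarrow> exp (- (0 / c))"
      using that by (intro tendsto_intros LIMSEQ_inverse_real_of_nat) auto
    then show ?thesis by (simp add: divide_inverse mult.commute)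
  qed
  have "(\<lambda>n. exp (- (1 / (real (Suc n) * (t - l)))) * exp (- (1 / (real (Suc n) * (u - t)))))
      \<longlonglongrightarrow> exp (- (0 / (t - l))) * exp (- (0 / (u - t)))"
    using True by (intro tendsto_mult *) auto
  moreover have "bump l u n t = exp (- (1 / (real (Suc n) * (t - l)))) * exp (- (1 / (real (Suc n) * (u - t))))" for n
    using True unfolding bump_def flat_def by (simp add: zero_less_mult_iff)
  ultimately show ?thesis using True by simp
next
  case False
  then have "bump l u n t = 0" for n using bump_eq_0_iff by blast
  with False show ?thesis by simp
qed

section \<open>The fundamental lemma of the calculus of variations\<close>

lemma borel_measurable_smooth: "smooth f \<Longrightarrow> f \<in> borel_measurable borel"
  using borel_measurable_continuous_onI smooth_continuous_on by blast

lemma measurable_lebesgue_on_smooth: "smooth f \<Longrightarrow> f \<in> borel_measurable (lebesgue_on \<Omega>)"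
  by (intro measurable_restrict_space1 measurable_completion) (simp add: borel_measurable_smooth)

lemma test_fun_smooth: "test_fun \<Omega> \<theta> \<Longrightarrow> smooth \<theta>"
  by (simp add: test_fun_def)

lemma test_fun_outside: "test_fun \<Omega> \<theta> \<Longrightarrow> x \<notin> \<Omega> \<Longrightarrow> \<theta> x = 0"
  unfolding test_fun_def using closure_subset[of "{x. \<theta> x \<noteq> 0}"] by auto

lemma test_fun_bounded:
  assumes "test_fun \<Omega> \<theta>" obtains B where "\<And>x. \<bar>\<theta> x\<bar> \<le> B"
proof -
  let ?K = "closure {x. \<theta> x \<noteq> 0}"
  have "compact (\<theta> ` ?K)"
    using assms by (auto simp: test_fun_def intro!: compact_continuous_image smooth_continuous_on)
  then have "bounded (\<theta> ` ?K)" by (rule compact_imp_bounded)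
  then obtain B where "\<forall>y\<in>\<theta> ` ?K. norm y \<le> B" unfolding bounded_iff ..
  then have B: "\<bar>\<theta> x\<bar> \<le> B" if "x \<in> ?K" for x using that by simp
  have "\<bar>\<theta> x\<bar> \<le> max B 0" for x
  proof (cases "\<theta> x = 0")
    case False
    then have "x \<in> ?K" using closure_subset[of "{x. \<theta> x \<noteq> 0}"] by auto
    then show ?thesis using B[of x] by linarith
  qed simp
  then show thesis using that by blast
qed

lemma test_funI:
  assumes "smooth \<theta>" "compact K" "K \<subseteq> \<Omega>" "\<And>x. x \<notin> K \<Longrightarrow> \<theta> x = 0"
  shows "test_fun \<Omega> \<theta>"
proof -
  have "closure {x. \<theta> x \<noteq> 0} \<subseteq> K"
    by (rule closure_minimal) (use assms(4) compact_imp_closed[OF assms(2)] in auto)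
  then have "K \<inter> closure {x. \<theta> x \<noteq> 0} = closure {x. \<theta> x \<noteq> 0}" by blast
  then have "compact (closure {x. \<theta> x \<noteq> 0})"
    using compact_Int_closed[OF assms(2) closed_closure, of "{x. \<theta> x \<noteq> 0}"] by simp
  with \<open>closure {x. \<theta> x \<noteq> 0} \<subseteq> K\<close> show ?thesis
    using assms(1,3) unfolding test_fun_def by (meson order_trans)
qed

lemma test_fun_suppE:
  assumes "test_fun \<Omega> \<theta>"
  obtains K where "compact K" "K \<subseteq> \<Omega>" "\<And>x. x \<notin> K \<Longrightarrow> \<theta> x = 0"
proof
  show "compact (closure {x. \<theta> x \<noteq> 0})" "closure {x. \<theta> x \<noteq> 0} \<subseteq> \<Omega>"
    using assms by (simp_all add: test_fun_def)
  show "\<theta> x = 0" if "x \<notin> closure {x. \<theta> x \<noteq> 0}" for x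
    using that closure_subset[of "{x. \<theta> x \<noteq> 0}"] by auto
qed

lemma integrable_mult_test_fun:
  assumes "integrable (lebesgue_on \<Omega>) g" "test_fun \<Omega> \<theta>"
  shows "integrable (lebesgue_on \<Omega>) (\<lambda>x. g x * \<theta> x)"
proof -
  obtain B where B: "\<And>x. \<bar>\<theta> x\<bar> \<le> B" using test_fun_bounded[OF assms(2)] by blast
  have [measurable]: "\<theta> \<in> borel_measurable (lebesgue_on \<Omega>)"
    using assms(2) by (simp add: test_fun_smooth measurable_lebesgue_on_smooth)
  have [measurable]: "g \<in> borel_measurable (lebesgue_on \<Omega>)" using assms(1) by auto
  show ?thesis
  proof (rule Bochner_Integration.integrable_bound)
    show "integrable (lebesgue_on \<Omega>) (\<lambda>x. B * g x)" using assms(1) by simp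
    have "\<bar>g x * \<theta> x\<bar> \<le> \<bar>B * g x\<bar>" for x
      using mult_left_mono[OF B[of x], of "\<bar>g x\<bar>"] B[of x] by (simp add: abs_mult mult.commute)
    then show "AE x in lebesgue_on \<Omega>. norm (g x * \<theta> x) \<le> norm (B * g x)" by simp
  qed measurable
qed

subsection \<open>Functions whose integral over every box vanishes\<close>

text \<open>The sets over which the integral vanishes form a Dynkin system containing the boxes, which
  are stable under intersection, hence contain all Borel sets, in particular the set where
  the function is positive.\<close>

lemma AE_zero_if_box_integrals_zero:
  fixes G :: "'a::euclidean_space \<Rightarrow> real"
  assumes int: "integrable lebesgue G"
    and box: "\<And>c d. (LINT x|lebesgue. indicator (box c d) x * G x) = 0"
    and outside: "\<And>x. x \<notin> box a b \<Longrightarrow> G x = 0"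
  shows "AE x in lebesgue. G x = 0"
proof -
  have "G \<in> borel_measurable lebesgue" using int by auto
  then obtain G' where G'[measurable]: "G' \<in> borel_measurable lborel" and "AE x in lborel. G x = G' x"
    using completion_ex_borel_measurable_real by blast
  then have ae: "AE x in lebesgue. G x = G' x" by (simp add: AE_completion)
  have intG': "integrable lborel G'"
  proof -
    have "integrable lebesgue G'"
      by (rule integrable_cong_AE_imp[OF int]) (use ae in \<open>auto intro: measurable_completion\<close>)
    then show ?thesis by (simp add: integrable_completion)
  qed
  have eq: "(LINT x|lborel. indicator A x * G' x) = (LINT x|lebesgue. indicator A x * G x)"
    if "A \<in> sets borel" for A
  proof -
    have [measurable]: "A \<in> sets lborel" using that by simp
    have "(LINT x|lborel. indicator A x * G' x) = (LINT x|lebesgue. indicator A x * G' x)"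
      by (rule integral_completion[symmetric]) measurable
    also have "\<dots> = (LINT x|lebesgue. indicator A x * G x)"
    proof (rule integral_cong_AE)
      show "(\<lambda>x. indicator A x * G' x) \<in> borel_measurable lebesgue"
        by (rule measurable_completion) measurable
      show "(\<lambda>x. indicator A x * G x) \<in> borel_measurable lebesgue"
        using that int by (intro borel_measurable_times borel_measurable_indicator) auto
      show "AE x in lebesgue. indicator A x * G' x = indicator A x * G x"
        using ae by eventually_elim simp
    qed
    finally show ?thesis .
  qed
  have tot: "(LINT x|lborel. G' x) = 0"
  proof -
    have "(LINT x|lborel. G' x) = (LINT x|lebesgue. G x)" using eq[of UNIV] by simp
    also have "(\<lambda>x. G x) = (\<lambda>x. indicator (box a b) x * G x)"
      by (rule ext) (use outside in \<open>auto simp: indicator_def\<close>)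
    finally show ?thesis using box by simp
  qed
  have all: "(LINT x|lborel. indicator A x * G' x) = 0" if "A \<in> sets borel" for A
  proof -
    have "A \<in> sigma_sets UNIV (range (\<lambda>(a, b). box a b :: 'a set))"
      using that by (subst (asm) borel_eq_box) simp
    then show ?thesis
    proof (induction rule: sigma_sets_induct_disjoint[rotated 2, consumes 1, case_names 3 4 5 6 1 2])
      case 1
      show ?case by (auto simp: Int_stable_def box_Int_box)
    next
      case 2
      show ?case by simp
    next
      case (3 A)
      then show ?case using eq box by auto
    next
      case 4
      show ?case by simp
    next
      case (5 A)
      have [measurable]: "A \<in> sets borel" using 5 by (subst borel_eq_box) simp
      have "(LINT x|lborel. indicator (UNIV - A) x * G' x) = (LINT x|lborel. G' x - indicator A x * G' x)"
        by (rule Bochner_Integration.integral_cong) (auto simp: indicator_def)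
      also have "\<dots> = 0"
        using intG' tot 5 integrable_mult_indicator[of A lborel G'] by simp
      finally show ?case .
    next
      case (6 A)
      have [measurable]: "A i \<in> sets borel" for i using 6 by (subst borel_eq_box) auto
      have "(LINT x:(\<Union>i. A i)|lborel. G' x) = (\<Sum>i. (LINT x:(A i)|lborel. G' x))"
      proof (rule lebesgue_integral_countable_add)
        show "A i \<inter> A j = {}" if "i \<noteq> j" for i j
          using 6 that by (auto simp: disjoint_family_on_def)
        show "set_integrable lborel (\<Union>i. A i) G'"
          unfolding set_integrable_def using intG' by (intro integrable_mult_indicator) auto
      qed auto
      then show ?case using 6 by (simp add: set_lebesgue_integral_def)
    qed
  qed
  let ?P = "{x. G' x > 0}"
  have "(LINT x|lborel. norm (G' x)) = (LINT x|lborel. indicator ?P x * G' x - indicator (- ?P) x * G' x)"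
    by (rule Bochner_Integration.integral_cong) (auto simp: indicator_def)
  also have "\<dots> = (LINT x|lborel. indicator ?P x * G' x) - (LINT x|lborel. indicator (- ?P) x * G' x)"
    using integrable_mult_indicator[OF _ intG', of ?P] integrable_mult_indicator[OF _ intG', of "- ?P"]
    by (intro Bochner_Integration.integral_diff) (auto simp: Compl_eq)
  also have "\<dots> = 0"
    using all[of ?P] all[of "- ?P"] by (simp add: Compl_eq)
  finally have "AE x in lborel. norm (G' x) = 0"
    using intG' by (subst (asm) integral_nonneg_eq_0_iff_AE) auto
  then have "AE x in lebesgue. G' x = 0" using AE_completion by auto
  with ae show ?thesis by eventually_elim simp
qed

text \<open>By the Lindelof property countably many boxes cover \<open>\<Omega>\<close>.\<close>

lemma AE_if_AE_boxes:
  fixes \<Omega> :: "'a::euclidean_space set"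
  assumes "open \<Omega>" and "\<And>a b. cbox a b \<subseteq> \<Omega> \<Longrightarrow> AE x in lebesgue. x \<in> box a b \<longrightarrow> P x"
  shows "AE x in lebesgue_on \<Omega>. P x"
proof -
  let ?F = "{box a b | a b. cbox a b \<subseteq> \<Omega>}"
  obtain F where F: "F \<subseteq> ?F" "countable F" "\<Union>F = \<Union>?F"
    using Lindelof[of ?F] by blast
  have "\<Omega> \<subseteq> \<Union>?F"
    using open_contains_cbox[OF \<open>open \<Omega>\<close>] by (smt (verit) UnionI mem_Collect_eq subsetI)
  moreover have "AE x in lebesgue. \<forall>B\<in>F. x \<in> B \<longrightarrow> P x"
    using F(1) assms(2) by (intro AE_ball_countable' F) auto
  ultimately have "AE x in lebesgue. x \<in> \<Omega> \<longrightarrow> P x"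
    using F(3) by (auto elim!: eventually_mono)
  then show ?thesis
    using \<open>open \<Omega>\<close> by (simp add: AE_restrict_space_iff)
qed

subsection \<open>Product test functions\<close>

text \<open>Each \<open>h j\<close> is a function of one real variable; its smoothness is expressed by that of
  the corresponding function of the \<open>j\<close>-th coordinate.\<close>

definition box_factors :: "real^3 \<Rightarrow> real^3 \<Rightarrow> (3 \<Rightarrow> real \<Rightarrow> real) \<Rightarrow> bool" where
  "box_factors a b h \<longleftrightarrow>
     (\<forall>j. smooth (\<lambda>x. h j (x $ j)) \<and> (\<forall>t. t \<notin> {a $ j..b $ j} \<longrightarrow> h j t = 0))"

definition factor_prod :: "(3 \<Rightarrow> real \<Rightarrow> real) \<Rightarrow> scalar_field" where
  "factor_prod h x = (\<Prod>j\<in>UNIV. h j (x $ j))"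

lemma test_fun_factor_prod:
  assumes "box_factors a b h" "cbox a b \<subseteq> \<Omega>"
  shows "test_fun \<Omega> (factor_prod h)"
proof (rule test_funI[of _ "cbox a b"])
  show "smooth (factor_prod h)"
    using assms(1) unfolding factor_prod_def box_factors_def by (intro smooth_prod) auto
  show "factor_prod h x = 0" if "x \<notin> cbox a b" for x
  proof -
    have "\<exists>j. x $ j \<notin> {a $ j..b $ j}" using that by (auto simp: mem_box_cart)
    then obtain j where "x $ j \<notin> {a $ j..b $ j}" by blast
    then show ?thesis using assms(1) unfolding factor_prod_def box_factors_def by (auto intro!: prod_zero)
  qed
qed (simp_all add: assms(2))

lemma box_factors_bump:
  assumes "\<And>j. a $ j \<le> c j" "\<And>j. d j \<le> b $ j"
  shows "box_factors a b (\<lambda>j. bump (c j) (d j) n)"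
  unfolding box_factors_def
proof (intro allI conjI impI)
  fix j t assume "t \<notin> {a $ j..b $ j}"
  then have "t \<notin> {c j<..<d j}" using assms[of j] by auto
  then show "bump (c j) (d j) n t = 0" using bump_eq_0_iff by blast
qed (rule smooth_bump)

text \<open>Products of bumps suffice as test functions: they converge boundedly to indicators of boxes.\<close>

lemma fundamental_lemma_box:
  assumes "open \<Omega>" and int: "integrable (lebesgue_on \<Omega>) g" and sub: "cbox a b \<subseteq> \<Omega>"
    and zero: "\<And>h. box_factors a b h \<Longrightarrow> (LINT x|lebesgue_on \<Omega>. g x * factor_prod h x) = 0"
  shows "AE x in lebesgue. x \<in> box a b \<longrightarrow> g x = 0"
proof -
  have \<Omega>[measurable]: "\<Omega> \<in> sets lebesgue" using assms(1) by simp
  have bsub: "box a b \<subseteq> \<Omega>" using sub box_subset_cbox by blast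
  define G where "G x = indicator (box a b) x * g x" for x
  have eqG: "G = (\<lambda>x. indicator (box a b) x *\<^sub>R (indicator \<Omega> x *\<^sub>R g x))"
    using bsub by (auto simp: G_def fun_eq_iff indicator_def)
  have "integrable lebesgue G"
    unfolding eqG
    by (rule integrable_mult_indicator) (use int \<Omega> in \<open>auto simp: integrable_restrict_space[of \<Omega> lebesgue g]\<close>)
  moreover have "(LINT x|lebesgue. indicator (box c d) x * G x) = 0" for c d
  proof -
    let ?h = "\<lambda>n j. bump (max (a $ j) (c $ j)) (min (b $ j) (d $ j)) n"
    have "(\<lambda>n. LINT x|lebesgue_on \<Omega>. g x * factor_prod (?h n) x) \<longlonglongrightarrow>
        (LINT x|lebesgue_on \<Omega>. indicator (box c d) x * G x)"
    proof (rule integral_dominated_convergence[where w = "\<lambda>x. \<bar>g x\<bar>"])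
      show "AE x in lebesgue_on \<Omega>. (\<lambda>n. g x * factor_prod (?h n) x) \<longlonglongrightarrow> indicator (box c d) x * G x"
      proof (rule AE_I2)
        fix x
        have "(\<lambda>n. g x * (\<Prod>j\<in>UNIV. ?h n j (x $ j))) \<longlonglongrightarrow>
          g x * (\<Prod>j\<in>UNIV. indicator {max (a $ j) (c $ j)<..<min (b $ j) (d $ j)} (x $ j))"
          by (intro tendsto_intros bump_tendsto)
        also have "g x * (\<Prod>j\<in>UNIV. indicator {max (a $ j) (c $ j)<..<min (b $ j) (d $ j)} (x $ j))
          = indicator (box c d) x * G x"
          by (auto simp: G_def indicator_def mem_box_cart prod_zero_iff)
        finally show "(\<lambda>n. g x * factor_prod (?h n) x) \<longlonglongrightarrow> indicator (box c d) x * G x"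
          by (simp add: factor_prod_def)
      qed
      show "AE x in lebesgue_on \<Omega>. norm (g x * factor_prod (?h n) x) \<le> \<bar>g x\<bar>" for n
      proof (rule AE_I2)
        fix x
        have "0 \<le> factor_prod (?h n) x" "factor_prod (?h n) x \<le> 1"
          unfolding factor_prod_def by (auto intro!: prod_nonneg prod_le_1 bump_bounds)
        then show "norm (g x * factor_prod (?h n) x) \<le> \<bar>g x\<bar>"
          by (simp add: abs_mult mult_left_le)
      qed
      show "integrable (lebesgue_on \<Omega>) (\<lambda>x. \<bar>g x\<bar>)" using int by simp
      show "(\<lambda>x. g x * factor_prod (?h n) x) \<in> borel_measurable (lebesgue_on \<Omega>)" for n
        using integrable_mult_test_fun[OF int test_fun_factor_prod[OF box_factors_bump sub]]
        by (auto intro!: borel_measurable_integrable)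
      have [measurable]: "G \<in> borel_measurable lebesgue" 
        using \<open>integrable lebesgue G\<close> by auto
      show "(\<lambda>x. indicator (box c d) x * G x) \<in> borel_measurable (lebesgue_on \<Omega>)"
        by (intro measurable_restrict_space1 borel_measurable_times borel_measurable_indicator) auto
    qed
    moreover have "(LINT x|lebesgue_on \<Omega>. g x * factor_prod (?h n) x) = 0" for n
      by (intro zero box_factors_bump) auto
    ultimately have "(LINT x|lebesgue_on \<Omega>. indicator (box c d) x * G x) = 0"
      by (simp add: LIMSEQ_const_iff)
    also have "(LINT x|lebesgue_on \<Omega>. indicator (box c d) x * G x) = (LINT x|lebesgue. indicator (box c d) x * G x)"
      using bsub by (subst integral_restrict_space) (auto simp: G_def indicator_def intro!: Bochner_Integration.integral_cong)
    finally show ?thesis .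
  qed
  ultimately have "AE x in lebesgue. G x = 0"
    by (rule AE_zero_if_box_integrals_zero[where a = a and b = b]) (auto simp: G_def)
  then show ?thesis
    by eventually_elim (auto simp: G_def)
qed

theorem fundamental_lemma:
  assumes "open \<Omega>" "integrable (lebesgue_on \<Omega>) g"
    and "\<And>\<theta>. test_fun \<Omega> \<theta> \<Longrightarrow> (LINT x|lebesgue_on \<Omega>. g x * \<theta> x) = 0"
  shows "AE x in lebesgue_on \<Omega>. g x = 0"
  using assms by (intro AE_if_AE_boxes fundamental_lemma_box) (auto intro: test_fun_factor_prod)


section \<open>The space of square integrable functions\<close>

lemma L2_measurable: "f \<in> L2 \<Omega> \<Longrightarrow> f \<in> borel_measurable (lebesgue_on \<Omega>)"
  by (simp add: L2_def)

lemma L2_norm_sq_integrable: "f \<in> L2 \<Omega> \<Longrightarrow> integrable (lebesgue_on \<Omega>) (\<lambda>x. (norm (f x))\<^sup>2)"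
  by (simp add: L2_def)

lemma L2_zero: "(\<lambda>x. 0) \<in> L2 \<Omega>"
  by (simp add: L2_def)

lemma L2_scaleR: "f \<in> L2 \<Omega> \<Longrightarrow> (\<lambda>x. c *\<^sub>R f x) \<in> L2 \<Omega>"
  by (auto simp: L2_def power_mult_distrib intro: borel_measurable_scaleR)

lemma L2_bound:
  assumes "h \<in> borel_measurable (lebesgue_on \<Omega>)" "integrable (lebesgue_on \<Omega>) u"
    and "\<And>x. (norm (h x))\<^sup>2 \<le> u x"
  shows "h \<in> L2 \<Omega>"
  unfolding L2_def
proof (intro CollectI conjI)
  show "integrable (lebesgue_on \<Omega>) (\<lambda>x. (norm (h x))\<^sup>2)"
  proof (rule Bochner_Integration.integrable_bound[OF assms(2)])
    show "(\<lambda>x. (norm (h x))\<^sup>2) \<in> borel_measurable (lebesgue_on \<Omega>)"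
      using assms(1) by measurable
    show "AE x in lebesgue_on \<Omega>. norm ((norm (h x))\<^sup>2) \<le> norm (u x)"
      using assms(3) by (intro AE_I2) (smt (verit) real_norm_def zero_le_power2)
  qed
qed (rule assms(1))

lemma L2_add:
  assumes "f \<in> L2 \<Omega>" "g \<in> L2 \<Omega>" shows "(\<lambda>x. f x + g x) \<in> L2 \<Omega>"
proof (rule L2_bound)
  show "(\<lambda>x. f x + g x) \<in> borel_measurable (lebesgue_on \<Omega>)"
    using assms by (intro borel_measurable_add L2_measurable)
  show "integrable (lebesgue_on \<Omega>) (\<lambda>x. 2 * (norm (f x))\<^sup>2 + 2 * (norm (g x))\<^sup>2)"
    using assms by (auto simp: L2_norm_sq_integrable)
  show "(norm (f x + g x))\<^sup>2 \<le> 2 * (norm (f x))\<^sup>2 + 2 * (norm (g x))\<^sup>2" for x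
  proof -
    have "(norm (f x + g x))\<^sup>2 + (norm (f x - g x))\<^sup>2 = 2 * (norm (f x))\<^sup>2 + 2 * (norm (g x))\<^sup>2"
      by (simp add: power2_norm_eq_inner inner_simps)
    then show ?thesis using zero_le_power2[of "norm (f x - g x)"] by linarith
  qed
qed

lemma L2_diff:
  assumes "f \<in> L2 \<Omega>" "g \<in> L2 \<Omega>" shows "(\<lambda>x. f x - g x) \<in> L2 \<Omega>"
  using L2_add[OF assms(1) L2_scaleR[OF assms(2), of "-1"]] by simp

lemma L2_inner_integrable:
  assumes "f \<in> L2 \<Omega>" "g \<in> L2 \<Omega>"
  shows "integrable (lebesgue_on \<Omega>) (\<lambda>x. f x \<bullet> g x)"
proof (rule Bochner_Integration.integrable_bound)
  show "integrable (lebesgue_on \<Omega>) (\<lambda>x. (norm (f x))\<^sup>2 + (norm (g x))\<^sup>2)"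
    using assms by (auto simp: L2_norm_sq_integrable)
  show "(\<lambda>x. f x \<bullet> g x) \<in> borel_measurable (lebesgue_on \<Omega>)"
    using assms by (intro borel_measurable_inner L2_measurable)
  have "norm (f x \<bullet> g x) \<le> norm ((norm (f x))\<^sup>2 + (norm (g x))\<^sup>2)" for x
  proof -
    have "\<bar>f x \<bullet> g x\<bar> \<le> norm (f x) * norm (g x)" by (rule Cauchy_Schwarz_ineq2)
    also have "\<dots> \<le> (norm (f x))\<^sup>2 + (norm (g x))\<^sup>2"
      using sum_squares_bound[of "norm (f x)" "norm (g x)"]
        mult_nonneg_nonneg[OF norm_ge_zero[of "f x"] norm_ge_zero[of "g x"]] by linarith
    finally show ?thesis by simp
  qed
  then show "AE x in lebesgue_on \<Omega>. norm (f x \<bullet> g x) \<le> norm ((norm (f x))\<^sup>2 + (norm (g x))\<^sup>2)"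
    by simp
qed

lemma l2_inner_commute: "l2_inner \<Omega> f g = l2_inner \<Omega> g f"
  by (simp add: l2_inner_def inner_commute)

lemma l2_inner_add_left:
  "f \<in> L2 \<Omega> \<Longrightarrow> g \<in> L2 \<Omega> \<Longrightarrow> h \<in> L2 \<Omega> \<Longrightarrow>
    l2_inner \<Omega> (\<lambda>x. f x + g x) h = l2_inner \<Omega> f h + l2_inner \<Omega> g h"
  unfolding l2_inner_def inner_add_left
  by (intro Bochner_Integration.integral_add L2_inner_integrable)

lemma l2_inner_diff_left:
  "f \<in> L2 \<Omega> \<Longrightarrow> g \<in> L2 \<Omega> \<Longrightarrow> h \<in> L2 \<Omega> \<Longrightarrow>
    l2_inner \<Omega> (\<lambda>x. f x - g x) h = l2_inner \<Omega> f h - l2_inner \<Omega> g h"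
  unfolding l2_inner_def inner_diff_left
  by (intro Bochner_Integration.integral_diff L2_inner_integrable)

lemma l2_inner_scaleR_left: "l2_inner \<Omega> (\<lambda>x. c *\<^sub>R f x) h = c * l2_inner \<Omega> f h"
  by (simp add: l2_inner_def)

lemma l2_inner_add_right:
  "f \<in> L2 \<Omega> \<Longrightarrow> g \<in> L2 \<Omega> \<Longrightarrow> h \<in> L2 \<Omega> \<Longrightarrow>
    l2_inner \<Omega> h (\<lambda>x. f x + g x) = l2_inner \<Omega> h f + l2_inner \<Omega> h g"
  using l2_inner_add_left by (simp add: l2_inner_commute)

lemma l2_inner_diff_right:
  "f \<in> L2 \<Omega> \<Longrightarrow> g \<in> L2 \<Omega> \<Longrightarrow> h \<in> L2 \<Omega> \<Longrightarrow>
    l2_inner \<Omega> h (\<lambda>x. f x - g x) = l2_inner \<Omega> h f - l2_inner \<Omega> h g"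
  using l2_inner_diff_left by (simp add: l2_inner_commute)

lemma l2_inner_scaleR_right: "l2_inner \<Omega> h (\<lambda>x. c *\<^sub>R f x) = c * l2_inner \<Omega> h f"
  by (simp add: l2_inner_def)

lemma l2_inner_uminus_left: "l2_inner \<Omega> (\<lambda>x. - f x) h = - l2_inner \<Omega> f h"
  by (simp add: l2_inner_def)

lemma l2_inner_zero [simp]: "l2_inner \<Omega> (\<lambda>x. 0) h = 0" "l2_inner \<Omega> h (\<lambda>x. 0) = 0"
  by (simp_all add: l2_inner_def)

lemma l2_inner_nonneg: "0 \<le> l2_inner \<Omega> f f"
  by (simp add: l2_inner_def)

lemma l2_inner_eq_0_iff:
  assumes "f \<in> L2 \<Omega>"
  shows "l2_inner \<Omega> f f = 0 \<longleftrightarrow> (AE x in lebesgue_on \<Omega>. f x = 0)"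
  using L2_inner_integrable[OF assms assms] unfolding l2_inner_def
  by (simp add: integral_nonneg_eq_0_iff_AE)

lemma l2_inner_cong_AE:
  assumes "f \<in> L2 \<Omega>" "f' \<in> L2 \<Omega>" "g \<in> L2 \<Omega>" and "AE x in lebesgue_on \<Omega>. f x = f' x"
  shows "l2_inner \<Omega> f g = l2_inner \<Omega> f' g"
  unfolding l2_inner_def
proof (rule integral_cong_AE)
  show "AE x in lebesgue_on \<Omega>. f x \<bullet> g x = f' x \<bullet> g x"
    using assms(4) by eventually_elim simp
qed (use assms L2_inner_integrable in \<open>auto intro: borel_measurable_integrable\<close>)

lemma l2_inner_eq_0_AE:
  assumes "AE x in lebesgue_on \<Omega>. f x = 0"
  shows "l2_inner \<Omega> f g = 0"
  unfolding l2_inner_def by (rule integral_eq_zero_AE) (use assms in eventually_elim, simp)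

lemma l2_norm_sq_scale_diff:
  assumes "f \<in> L2 \<Omega>" "g \<in> L2 \<Omega>"
  shows "l2_inner \<Omega> (\<lambda>x. f x - t *\<^sub>R g x) (\<lambda>x. f x - t *\<^sub>R g x) =
    l2_inner \<Omega> f f - 2 * t * l2_inner \<Omega> f g + t\<^sup>2 * l2_inner \<Omega> g g"
  using assms
  by (simp add: l2_inner_diff_left l2_inner_diff_right l2_inner_scaleR_left l2_inner_scaleR_right
      L2_diff L2_scaleR l2_inner_commute[of \<Omega> g f] algebra_simps power2_eq_square)

lemma nonneg_quadratic_discriminant:
  fixes a b c :: real
  assumes "\<And>t. 0 \<le> a - 2 * t * b + t\<^sup>2 * c" "0 \<le> c"
  shows "b\<^sup>2 \<le> a * c"
proof (cases "c = 0")
  case True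
  have "b = 0"
  proof (rule ccontr)
    assume "b \<noteq> 0"
    then show False using assms(1)[of "(a + 1) / (2 * b)"] True by (simp add: field_simps)
  qed
  then show ?thesis using True by simp
next
  case False
  then have "c > 0" using assms(2) by simp
  then show ?thesis using assms(1)[of "b / c"] by (simp add: field_simps power2_eq_square)
qed

lemma l2_Cauchy_Schwarz:
  assumes "f \<in> L2 \<Omega>" "g \<in> L2 \<Omega>"
  shows "(l2_inner \<Omega> f g)\<^sup>2 \<le> l2_inner \<Omega> f f * l2_inner \<Omega> g g"
  using nonneg_quadratic_discriminant l2_norm_sq_scale_diff[OF assms, symmetric] l2_inner_nonneg
  by (metis (no_types, lifting))

lemma l2_inner_tendsto_zero:
  assumes "\<And>n. f n \<in> L2 \<Omega>" "g \<in> L2 \<Omega>"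
    and "(\<lambda>n. l2_inner \<Omega> (f n) (f n)) \<longlonglongrightarrow> 0"
  shows "(\<lambda>n. l2_inner \<Omega> (f n) g) \<longlonglongrightarrow> 0"
proof -
  have "(\<lambda>n. sqrt (l2_inner \<Omega> (f n) (f n) * l2_inner \<Omega> g g)) \<longlonglongrightarrow> sqrt (0 * l2_inner \<Omega> g g)"
    by (intro tendsto_intros assms(3))
  then have "(\<lambda>n. sqrt (l2_inner \<Omega> (f n) (f n) * l2_inner \<Omega> g g)) \<longlonglongrightarrow> 0" by simp
  moreover have "norm (l2_inner \<Omega> (f n) g) \<le> sqrt (l2_inner \<Omega> (f n) (f n) * l2_inner \<Omega> g g)" for n
    by (rule real_le_rsqrt) (simp add: l2_Cauchy_Schwarz assms(1,2))
  ultimately show ?thesis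
    by (rule Lim_null_comparison[OF always_eventually[OF allI], rotated])
qed

lemma l2_inner_tendsto:
  assumes "\<And>n. f n \<in> L2 \<Omega>" "h \<in> L2 \<Omega>" "g \<in> L2 \<Omega>"
    and "(\<lambda>n. l2_inner \<Omega> (\<lambda>x. f n x - h x) (\<lambda>x. f n x - h x)) \<longlonglongrightarrow> 0"
  shows "(\<lambda>n. l2_inner \<Omega> (f n) g) \<longlonglongrightarrow> l2_inner \<Omega> h g"
proof -
  have "(\<lambda>n. l2_inner \<Omega> (\<lambda>x. f n x - h x) g) \<longlonglongrightarrow> 0"
    by (intro l2_inner_tendsto_zero L2_diff assms)
  then have "(\<lambda>n. l2_inner \<Omega> (f n) g - l2_inner \<Omega> h g) \<longlonglongrightarrow> 0"
    using assms(1-3) by (simp add: l2_inner_diff_left)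
  then show ?thesis by (simp add: LIM_zero_iff)
qed

subsection \<open>Completeness\<close>

lemma nn_integral_norm_sq:
  assumes "f \<in> L2 \<Omega>"
  shows "(\<integral>\<^sup>+x. ennreal ((norm (f x))\<^sup>2) \<partial>lebesgue_on \<Omega>) = ennreal (l2_inner \<Omega> f f)"
  using nn_integral_eq_integral[OF L2_norm_sq_integrable[OF assms]]
  by (simp add: l2_inner_def power2_norm_eq_inner)

text \<open>The sum of \<open>4 ^ n * (norm (f (Suc n) x - f n x))\<^sup>2\<close> has a finite integral, hence is finite almost
  everywhere, and then the increments decrease like \<open>(1 / 2) ^ n\<close>.\<close>

lemma L2_summable_AE_convergent:
  fixes f :: "nat \<Rightarrow> real^3 \<Rightarrow> 'b::euclidean_space"
  assumes f: "\<And>n. f n \<in> L2 \<Omega>"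
    and rate: "\<And>n. l2_inner \<Omega> (\<lambda>x. f (Suc n) x - f n x) (\<lambda>x. f (Suc n) x - f n x) \<le> (1 / 16) ^ n"
  shows "AE x in lebesgue_on \<Omega>. convergent (\<lambda>n. f n x)"
proof -
  let ?d = "\<lambda>n x. f (Suc n) x - f n x"
  let ?w = "\<lambda>n x. ennreal (4 ^ n * (norm (?d n x))\<^sup>2)"
  have d: "?d n \<in> L2 \<Omega>" for n using f by (intro L2_diff)
  have [measurable]: "f n \<in> borel_measurable (lebesgue_on \<Omega>)" for n using f by (rule L2_measurable)
  have "(\<integral>\<^sup>+x. (\<Sum>n. ?w n x) \<partial>lebesgue_on \<Omega>) = (\<Sum>n. \<integral>\<^sup>+x. ?w n x \<partial>lebesgue_on \<Omega>)"
    by (rule nn_integral_suminf) measurable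
  also have "\<dots> \<le> (\<Sum>n. ennreal ((1 / 4) ^ n))"
  proof (rule suminf_le)
    fix n
    have "(\<integral>\<^sup>+x. ?w n x \<partial>lebesgue_on \<Omega>) = ennreal (4 ^ n) * ennreal (l2_inner \<Omega> (?d n) (?d n))"
      by (simp add: ennreal_mult nn_integral_cmult nn_integral_norm_sq[OF d])
    also have "\<dots> = ennreal (4 ^ n * l2_inner \<Omega> (?d n) (?d n))"
      by (simp add: ennreal_mult l2_inner_nonneg)
    also have "4 ^ n * l2_inner \<Omega> (?d n) (?d n) \<le> 4 ^ n * (1 / 16) ^ n"
      by (rule mult_left_mono[OF rate]) simp
    also have "(4::real) ^ n * (1 / 16) ^ n = (1 / 4) ^ n"
      by (simp flip: power_mult_distrib)
    finally show "(\<integral>\<^sup>+x. ?w n x \<partial>lebesgue_on \<Omega>) \<le> ennreal ((1 / 4) ^ n)"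
      by (simp add: ennreal_leI)
  qed auto
  also have "\<dots> < \<infinity>"
    by (simp add: suminf_ennreal2 summable_geometric)
  finally have "AE x in lebesgue_on \<Omega>. (\<Sum>n. ?w n x) \<noteq> \<infinity>"
    by (intro nn_integral_PInf_AE) auto
  then show ?thesis
  proof eventually_elim
    fix x assume "(\<Sum>n. ?w n x) \<noteq> \<infinity>"
    then obtain B where B: "(\<Sum>n. ?w n x) = ennreal B" "B \<ge> 0"
      using less_top_ennreal[of "\<Sum>n. ?w n x"] unfolding infinity_ennreal_def less_top by blast
    have le: "norm (?d n x) \<le> sqrt B * (1 / 2) ^ n" for n
    proof -
      have "sum (\<lambda>n. ?w n x) {n} \<le> (\<Sum>n. ?w n x)" by (rule sum_le_suminf) auto
      then have "?w n x \<le> ennreal B" unfolding B(1) by simp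
      then have "4 ^ n * (norm (?d n x))\<^sup>2 \<le> B" by (simp only: ennreal_le_iff[OF B(2)])
      moreover have "(2 ^ n * norm (?d n x))\<^sup>2 = 4 ^ n * (norm (?d n x))\<^sup>2"
        using power_mult_distrib[of "2::real" 2 n] by (simp add: power_mult_distrib power2_eq_square)
      ultimately have "2 ^ n * norm (?d n x) \<le> sqrt B" by (simp add: real_le_rsqrt)
      then show ?thesis by (simp add: field_simps)
    qed
    have "summable (\<lambda>n. sqrt B * (1 / 2) ^ n)"
      by (intro summable_mult summable_geometric) simp
    then have "summable (\<lambda>n. ?d n x)"
      by (rule summable_comparison_test'[where N = 0]) (rule le)
    then have "convergent (\<lambda>n. f 0 x + (\<Sum>i<n. ?d i x))"
      by (intro convergent_add convergent_const) (simp add: summable_iff_convergent)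
    then show "convergent (\<lambda>n. f n x)" by (simp add: sum_lessThan_telescope[of "\<lambda>n. f n x"])
  qed
qed

text \<open>A fast subsequence converges pointwise almost everywhere; Fatou's lemma shows that its limit is
  in \<open>L\<^sup>2\<close> and is the limit of the whole sequence in norm.\<close>

theorem L2_complete:
  fixes f :: "nat \<Rightarrow> real^3 \<Rightarrow> 'b::euclidean_space"
  assumes f: "\<And>n. f n \<in> L2 \<Omega>"
    and Cauchy: "\<And>e. e > 0 \<Longrightarrow> \<exists>N. \<forall>m\<ge>N. \<forall>n\<ge>N. l2_inner \<Omega> (\<lambda>x. f m x - f n x) (\<lambda>x. f m x - f n x) \<le> e"
  obtains g where "g \<in> L2 \<Omega>" "(\<lambda>n. l2_inner \<Omega> (\<lambda>x. f n x - g x) (\<lambda>x. f n x - g x)) \<longlonglongrightarrow> 0"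
proof -
  let ?D = "\<lambda>m n. l2_inner \<Omega> (\<lambda>x. f m x - f n x) (\<lambda>x. f m x - f n x)"
  have "\<forall>j. \<exists>N. \<forall>m\<ge>N. \<forall>n\<ge>N. ?D m n \<le> (1 / 16) ^ j" by (intro allI Cauchy) simp
  then obtain N where N: "\<And>j m n. N j \<le> m \<Longrightarrow> N j \<le> n \<Longrightarrow> ?D m n \<le> (1 / 16) ^ j" by metis
  \<comment> \<open>A partial sum is at least each of its terms, so \<open>k n\<close> lies beyond every threshold up to the \<open>n\<close>-th.\<close>
  define k where "k n = (\<Sum>j\<le>n. N j)" for n
  have k: "N j \<le> k n" if "j \<le> n" for j n
    unfolding k_def using that by (intro member_le_sum) auto
  define g where "g x = lim (\<lambda>n. f (k n) x)" for x
  have "AE x in lebesgue_on \<Omega>. convergent (\<lambda>n. f (k n) x)"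
  proof (rule L2_summable_AE_convergent)
    show "?D (k (Suc n)) (k n) \<le> (1 / 16) ^ n" for n by (intro N k) auto
  qed (rule f)
  then have lim: "AE x in lebesgue_on \<Omega>. (\<lambda>n. f (k n) x) \<longlonglongrightarrow> g x"
    by eventually_elim (simp add: g_def convergent_LIMSEQ_iff)
  have [measurable]: "f n \<in> borel_measurable (lebesgue_on \<Omega>)" for n using f by (rule L2_measurable)
  have [measurable]: "g \<in> borel_measurable (lebesgue_on \<Omega>)" unfolding g_def by measurable
  have bound: "(\<integral>\<^sup>+x. ennreal ((norm (f m x - g x))\<^sup>2) \<partial>lebesgue_on \<Omega>) \<le> ennreal ((1 / 16) ^ j)"
    if "N j \<le> m" for m j
  proof -
    have "(\<integral>\<^sup>+x. ennreal ((norm (f m x - g x))\<^sup>2) \<partial>lebesgue_on \<Omega>) =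
        (\<integral>\<^sup>+x. liminf (\<lambda>n. ennreal ((norm (f m x - f (k n) x))\<^sup>2)) \<partial>lebesgue_on \<Omega>)"
    proof (rule nn_integral_cong_AE)
      show "AE x in lebesgue_on \<Omega>. ennreal ((norm (f m x - g x))\<^sup>2) =
          liminf (\<lambda>n. ennreal ((norm (f m x - f (k n) x))\<^sup>2))"
        using lim
      proof eventually_elim
        fix x assume "(\<lambda>n. f (k n) x) \<longlonglongrightarrow> g x"
        then have "(\<lambda>n. ennreal ((norm (f m x - f (k n) x))\<^sup>2)) \<longlonglongrightarrow> ennreal ((norm (f m x - g x))\<^sup>2)"
          by (intro tendsto_intros)
        then show "ennreal ((norm (f m x - g x))\<^sup>2) = liminf (\<lambda>n. ennreal ((norm (f m x - f (k n) x))\<^sup>2))"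
          by (rule lim_imp_Liminf[OF trivial_limit_sequentially, symmetric])
      qed
    qed
    also have "\<dots> \<le> liminf (\<lambda>n. \<integral>\<^sup>+x. ennreal ((norm (f m x - f (k n) x))\<^sup>2) \<partial>lebesgue_on \<Omega>)"
      by (rule nn_integral_liminf) measurable
    also have "\<dots> = liminf (\<lambda>n. ennreal (?D m (k n)))"
      by (subst nn_integral_norm_sq) (auto intro: L2_diff f)
    also have "\<dots> \<le> ennreal ((1 / 16) ^ j)"
    proof (rule Liminf_le)
      show "\<forall>\<^sub>F n in sequentially. ennreal (?D m (k n)) \<le> ennreal ((1 / 16) ^ j)"
        using eventually_ge_at_top[of j]
        by eventually_elim (intro ennreal_leI N that k)
    qed simp
    finally show ?thesis .
  qed
  have diff: "(\<lambda>x. f m x - g x) \<in> L2 \<Omega>" if "N j \<le> m" for m j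
    unfolding L2_def
  proof (intro CollectI conjI)
    show "integrable (lebesgue_on \<Omega>) (\<lambda>x. (norm (f m x - g x))\<^sup>2)"
      using bound[OF that] by (intro integrableI_nonneg) (auto simp: le_less_trans)
  qed measurable
  have g: "g \<in> L2 \<Omega>"
    using L2_diff[OF f[of "N 0"] diff[of 0 "N 0"]] by simp
  have *: "l2_inner \<Omega> (\<lambda>x. f m x - g x) (\<lambda>x. f m x - g x) \<le> (1 / 16) ^ j" if "N j \<le> m" for m j
    using bound[OF that] unfolding nn_integral_norm_sq[OF L2_diff[OF f g]] by (simp add: ennreal_le_iff)
  have "(\<lambda>m. l2_inner \<Omega> (\<lambda>x. f m x - g x) (\<lambda>x. f m x - g x)) \<longlonglongrightarrow> 0"
  proof (intro metric_LIMSEQ_I)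
    fix e :: real assume "0 < e"
    obtain j where "(1 / 16) ^ j < e" using real_arch_pow_inv[OF \<open>0 < e\<close>, of "1 / 16"] by auto
    then have "l2_inner \<Omega> (\<lambda>x. f m x - g x) (\<lambda>x. f m x - g x) < e" if "N j \<le> m" for m
      using *[OF that] by linarith
    then show "\<exists>M. \<forall>m\<ge>M. dist (l2_inner \<Omega> (\<lambda>x. f m x - g x) (\<lambda>x. f m x - g x)) 0 < e"
      by (intro exI[of _ "N j"]) (simp add: dist_real_def l2_inner_nonneg)
  qed
  then show thesis using that g by blast
qed

subsection \<open>Orthogonal projection onto a closed subspace\<close>

text \<open>A minimizing sequence for the distance is a Cauchy sequence by the parallelogram law. The
  subspace is a set of functions, not of equivalence classes; closedness therefore includes
  closedness under changes on null sets.\<close>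

theorem L2_projection:
  fixes S :: "(real^3 \<Rightarrow> 'b::euclidean_space) set"
  assumes S: "S \<subseteq> L2 \<Omega>" "S \<noteq> {}"
    and add: "\<And>v w. v \<in> S \<Longrightarrow> w \<in> S \<Longrightarrow> (\<lambda>x. v x + w x) \<in> S"
    and scale: "\<And>c v. v \<in> S \<Longrightarrow> (\<lambda>x. c *\<^sub>R v x) \<in> S"
    and closed: "\<And>f g. (\<And>n. f n \<in> S) \<Longrightarrow> g \<in> L2 \<Omega> \<Longrightarrow>
      (\<lambda>n. l2_inner \<Omega> (\<lambda>x. f n x - g x) (\<lambda>x. f n x - g x)) \<longlonglongrightarrow> 0 \<Longrightarrow> g \<in> S"
    and F: "F \<in> L2 \<Omega>"
  obtains P where "P \<in> S" "\<And>v. v \<in> S \<Longrightarrow> l2_inner \<Omega> (\<lambda>x. F x - P x) v = 0"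
proof -
  let ?E = "\<lambda>v. l2_inner \<Omega> (\<lambda>x. F x - v x) (\<lambda>x. F x - v x)"
  define d where "d = Inf (?E ` S)"
  have bdd: "bdd_below (?E ` S)" by (rule bdd_belowI2[of _ 0]) (rule l2_inner_nonneg)
  have d: "d \<le> ?E v" if "v \<in> S" for v
    unfolding d_def using that bdd by (intro cInf_lower) auto
  have "\<exists>v\<in>S. ?E v < d + inverse (real (Suc n))" for n
    using cInf_lessD[of "?E ` S" "d + inverse (real (Suc n))"] S(2) unfolding d_def by auto
  then obtain v where v: "\<And>n. v n \<in> S" "\<And>n. ?E (v n) < d + inverse (real (Suc n))" by metis
  have vL: "v n \<in> L2 \<Omega>" for n using v S by blast
  have par: "l2_inner \<Omega> (\<lambda>x. v m x - v n x) (\<lambda>x. v m x - v n x) \<le>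
      2 * inverse (real (Suc m)) + 2 * inverse (real (Suc n))" for m n
  proof -
    have mid: "(\<lambda>x. (1/2) *\<^sub>R (v m x + v n x)) \<in> S" by (intro scale add v)
    have "l2_inner \<Omega> (\<lambda>x. v m x - v n x) (\<lambda>x. v m x - v n x) =
        2 * ?E (v m) + 2 * ?E (v n) - 4 * ?E (\<lambda>x. (1/2) *\<^sub>R (v m x + v n x))"
      using vL[of m] vL[of n] F
      by (simp add: l2_inner_diff_left l2_inner_diff_right l2_inner_add_left l2_inner_add_right
          l2_inner_scaleR_left l2_inner_scaleR_right L2_diff L2_add L2_scaleR
          l2_inner_commute[of \<Omega> "v n" "v m"] l2_inner_commute[of \<Omega> F "v m"] l2_inner_commute[of \<Omega> F "v n"]
          algebra_simps del: scaleR_add_right scaleR_right_distrib)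
    then show ?thesis using d[OF mid] v(2)[of m] v(2)[of n] by linarith
  qed
  obtain P where P: "P \<in> L2 \<Omega>" and lim: "(\<lambda>n. l2_inner \<Omega> (\<lambda>x. v n x - P x) (\<lambda>x. v n x - P x)) \<longlonglongrightarrow> 0"
  proof (rule L2_complete[OF vL])
    fix e :: real assume "0 < e"
    then obtain N where N: "inverse (real (Suc N)) < e / 4"
      using reals_Archimedean[of "e / 4"] by auto
    have "l2_inner \<Omega> (\<lambda>x. v m x - v n x) (\<lambda>x. v m x - v n x) \<le> e" if "m \<ge> N" "n \<ge> N" for m n
    proof -
      have "inverse (real (Suc m)) \<le> inverse (real (Suc N))" "inverse (real (Suc n)) \<le> inverse (real (Suc N))"
        using that by (auto intro!: le_imp_inverse_le)
      then show ?thesis using par[of m n] N by linarith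
    qed
    then show "\<exists>N. \<forall>m\<ge>N. \<forall>n\<ge>N. l2_inner \<Omega> (\<lambda>x. v m x - v n x) (\<lambda>x. v m x - v n x) \<le> e" by blast
  qed (use that in blast)
  have PS: "P \<in> S" by (rule closed[OF v(1) P lim])
  have "?E P \<le> d"
  proof (rule LIMSEQ_le)
    have FP: "(\<lambda>x. F x - P x) \<in> L2 \<Omega>" by (intro L2_diff F P)
    have "(\<lambda>n. ?E P + 2 * (l2_inner \<Omega> P (\<lambda>x. F x - P x) - l2_inner \<Omega> (v n) (\<lambda>x. F x - P x))
        + l2_inner \<Omega> (\<lambda>x. v n x - P x) (\<lambda>x. v n x - P x))
      \<longlonglongrightarrow> ?E P + 2 * (l2_inner \<Omega> P (\<lambda>x. F x - P x) - l2_inner \<Omega> P (\<lambda>x. F x - P x)) + 0"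
      by (intro tendsto_intros lim l2_inner_tendsto[OF vL P FP lim])
    moreover have "?E (v n) = ?E P + 2 * (l2_inner \<Omega> P (\<lambda>x. F x - P x) - l2_inner \<Omega> (v n) (\<lambda>x. F x - P x))
        + l2_inner \<Omega> (\<lambda>x. v n x - P x) (\<lambda>x. v n x - P x)" for n
    proof -
      have "l2_inner \<Omega> (\<lambda>x. F x - P x) (\<lambda>x. v n x - P x) =
          l2_inner \<Omega> (v n) (\<lambda>x. F x - P x) - l2_inner \<Omega> P (\<lambda>x. F x - P x)"
        by (subst l2_inner_diff_right[OF vL P FP]) (simp only: l2_inner_commute[of \<Omega> "\<lambda>x. F x - P x"])
      then show ?thesis
        using l2_norm_sq_scale_diff[OF FP L2_diff[OF vL[of n] P], of 1] by simp
    qed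
    ultimately show "(\<lambda>n. ?E (v n)) \<longlonglongrightarrow> ?E P" by simp
    show "(\<lambda>n. d + inverse (real (Suc n))) \<longlonglongrightarrow> d"
      using tendsto_add[OF tendsto_const[of d] LIMSEQ_inverse_real_of_nat] by simp
    show "\<exists>N. \<forall>n\<ge>N. ?E (v n) \<le> d + inverse (real (Suc n))" using v(2) less_imp_le by blast
  qed
  have "l2_inner \<Omega> (\<lambda>x. F x - P x) u = 0" if u: "u \<in> S" for u
  proof -
    have uL: "u \<in> L2 \<Omega>" using u S by blast
    have "0 \<le> 0 - 2 * t * l2_inner \<Omega> (\<lambda>x. F x - P x) u + t\<^sup>2 * l2_inner \<Omega> u u" for t
    proof -
      have "?E P \<le> ?E (\<lambda>x. P x + t *\<^sub>R u x)"
        using \<open>?E P \<le> d\<close> d[OF add[OF PS scale[OF u, of t]]] by linarith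
      then show ?thesis
        using l2_norm_sq_scale_diff[OF L2_diff[OF F P] uL, of t] by (simp add: diff_diff_eq)
    qed
    from nonneg_quadratic_discriminant[OF this l2_inner_nonneg] show ?thesis by simp
  qed
  then show thesis using that PS by blast
qed

section \<open>Calculus of test functions\<close>

lemma test_fun_partial:
  assumes "test_fun \<Omega> \<theta>" shows "test_fun \<Omega> (partial i \<theta>)"
proof -
  obtain K where K: "compact K" "K \<subseteq> \<Omega>" "\<And>x. x \<notin> K \<Longrightarrow> \<theta> x = 0"
    using test_fun_suppE[OF assms] by blast
  show ?thesis
  proof (rule test_funI[OF smooth_partial[OF test_fun_smooth[OF assms]] K(1,2)])
    fix x assume "x \<notin> K"
    have "(\<theta> has_derivative (\<lambda>_. 0)) (at x)"
      by (rule has_derivative_transform_within_open[where s = "- K" and f = "\<lambda>_. 0"])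
         (use K \<open>x \<notin> K\<close> in \<open>auto intro: compact_imp_closed\<close>)
    then show "partial i \<theta> x = 0" by (simp add: partial_eqI)
  qed
qed

lemma test_fun_add:
  assumes "test_fun \<Omega> \<theta>" "test_fun \<Omega> \<eta>" shows "test_fun \<Omega> (\<lambda>x. \<theta> x + \<eta> x)"
proof -
  obtain K L where "compact K" "K \<subseteq> \<Omega>" "\<And>x. x \<notin> K \<Longrightarrow> \<theta> x = 0"
    "compact L" "L \<subseteq> \<Omega>" "\<And>x. x \<notin> L \<Longrightarrow> \<eta> x = 0"
    using test_fun_suppE assms by metis
  then show ?thesis
    using assms by (intro test_funI[of _ "K \<union> L"]) (auto intro: smooth_add test_fun_smooth)
qed

lemma test_fun_mult:
  assumes "smooth \<eta>" "test_fun \<Omega> \<theta>" shows "test_fun \<Omega> (\<lambda>x. \<eta> x * \<theta> x)"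
proof -
  obtain K where "compact K" "K \<subseteq> \<Omega>" "\<And>x. x \<notin> K \<Longrightarrow> \<theta> x = 0"
    using test_fun_suppE assms by metis
  then show ?thesis
    using assms by (intro test_funI[of _ K]) (auto intro: smooth_mult test_fun_smooth)
qed

lemma test_fun_uminus: "test_fun \<Omega> \<theta> \<Longrightarrow> test_fun \<Omega> (\<lambda>x. - \<theta> x)"
  using test_fun_mult[OF smooth_const[of "-1"]] by simp

lemma test_fun_diff: "test_fun \<Omega> \<theta> \<Longrightarrow> test_fun \<Omega> \<eta> \<Longrightarrow> test_fun \<Omega> (\<lambda>x. \<theta> x - \<eta> x)"
  using test_fun_add[OF _ test_fun_uminus] by fastforce

lemma test_fun_zero: "test_fun \<Omega> (\<lambda>x. 0)"
  by (rule test_funI[of _ "{}"]) (auto intro: smooth_const)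

lemma integral_test_fun_lborel:
  assumes "\<Omega> \<in> sets lebesgue" "test_fun \<Omega> \<theta>"
  shows "(LINT x|lebesgue_on \<Omega>. \<theta> x) = (LINT x|lborel. \<theta> x)"
proof -
  have "(LINT x|lebesgue_on \<Omega>. \<theta> x) = (LINT x|lebesgue. indicator \<Omega> x *\<^sub>R \<theta> x)"
    using assms(1) by (intro integral_restrict_space) simp
  also have "(\<lambda>x. indicator \<Omega> x *\<^sub>R \<theta> x) = \<theta>"
    using test_fun_outside[OF assms(2)] by (auto simp: fun_eq_iff indicator_def)
  also have "(LINT x|lebesgue. \<theta> x) = (LINT x|lborel. \<theta> x)"
    using borel_measurable_smooth[OF test_fun_smooth[OF assms(2)]] by (intro integral_completion) simp
  finally show ?thesis .
qed

lemma integrable_lborel_test_fun: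
  assumes "test_fun \<Omega> \<theta>" shows "integrable lborel \<theta>"
proof -
  obtain K where K: "compact K" "K \<subseteq> \<Omega>" "\<And>x. x \<notin> K \<Longrightarrow> \<theta> x = 0"
    using test_fun_suppE[OF assms] by blast
  have "integrable lborel (\<lambda>x. indicator K x *\<^sub>R \<theta> x)"
    by (rule borel_integrable_compact[OF K(1) smooth_continuous_on[OF test_fun_smooth[OF assms]]])
  also have "(\<lambda>x. indicator K x *\<^sub>R \<theta> x) = \<theta>"
    using K(3) by (auto simp: fun_eq_iff indicator_def)
  finally show ?thesis .
qed

lemma integral_lborel_translation:
  fixes f :: "'a::euclidean_space \<Rightarrow> real"
  assumes "f \<in> borel_measurable borel"
  shows "(LINT x|lborel. f (a + x)) = (LINT x|lborel. f x)"
proof -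
  have "(LINT x|lborel. f x) = (LINT x|distr lborel borel ((+) a). f x)"
    by (simp add: lborel_distr_plus)
  also have "\<dots> = (LINT x|lborel. f (a + x))"
    using assms by (intro integral_distr) auto
  finally show ?thesis by simp
qed

text \<open>By translation invariance the integrals of the difference quotients vanish; they converge
  to the partial derivative and are dominated by a multiple of the indicator of a ball.\<close>

theorem integral_partial_test_fun:
  assumes "\<Omega> \<in> sets lebesgue" "test_fun \<Omega> \<theta>"
  shows "(LINT x|lebesgue_on \<Omega>. partial i \<theta> x) = 0"
proof -
  let ?e = "axis i 1 :: real^3"
  let ?h = "\<lambda>n. inverse (real (Suc n))"
  let ?q = "\<lambda>n x. (\<theta> (?h n *\<^sub>R ?e + x) - \<theta> x) / ?h n"
  have sm: "smooth \<theta>" using assms(2) by (rule test_fun_smooth)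
  note [measurable] = borel_measurable_smooth[OF sm] borel_measurable_smooth[OF smooth_partial[OF sm]]
  obtain B where B: "\<And>x. \<bar>partial i \<theta> x\<bar> \<le> B"
    using test_fun_bounded[OF test_fun_partial[OF assms(2)]] by blast
  then have B0: "0 \<le> B" using abs_ge_zero order_trans by blast
  obtain K where K: "compact K" "K \<subseteq> \<Omega>" "\<And>x. x \<notin> K \<Longrightarrow> \<theta> x = 0"
    using test_fun_suppE[OF assms(2)] by blast
  obtain R where R: "\<And>x. x \<in> K \<Longrightarrow> norm x \<le> R"
    using compact_imp_bounded[OF K(1)] unfolding bounded_iff by blast
  have line: "((\<lambda>s. \<theta> (s *\<^sub>R ?e + x)) has_real_derivative partial i \<theta> (s *\<^sub>R ?e + x)) (at s)" for x s
    using partial_along_line[OF smooth_differentiable[OF sm], of x i s] by (simp add: add.commute)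
  have h: "0 < ?h n" "?h n \<le> 1" for n by (auto simp: inverse_le_1_iff)
  have bound: "\<bar>?q n x\<bar> \<le> B * indicator (cball 0 (R + 1)) x" for n x
  proof (cases "x \<in> cball 0 (R + 1)")
    case True
    obtain z where "\<theta> (?h n *\<^sub>R ?e + x) - \<theta> (0 *\<^sub>R ?e + x) = (?h n - 0) * partial i \<theta> (z *\<^sub>R ?e + x)"
      using MVT2[OF h(1)[of n], of "\<lambda>s. \<theta> (s *\<^sub>R ?e + x)" "\<lambda>s. partial i \<theta> (s *\<^sub>R ?e + x)"] line by blast
    then have "?q n x = partial i \<theta> (z *\<^sub>R ?e + x)" using h(1)[of n] by simp
    then show ?thesis using B True by simp
  next
    case False
    have "x \<notin> K" using False R by force
    moreover have "?h n *\<^sub>R ?e + x \<notin> K"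
    proof
      assume "?h n *\<^sub>R ?e + x \<in> K"
      then have "norm (?h n *\<^sub>R ?e + x) \<le> R" by (rule R)
      moreover have "norm (?h n *\<^sub>R ?e) \<le> 1" using h[of n] by (simp add: norm_axis_1)
      ultimately have "norm x \<le> R + 1"
        using norm_triangle_ineq4[of "?h n *\<^sub>R ?e + x" "?h n *\<^sub>R ?e"] by simp
      then show False using False by simp
    qed
    ultimately show ?thesis using K(3) B0 by (simp add: indicator_def)
  qed
  have "(\<lambda>n. LINT x|lborel. ?q n x) \<longlonglongrightarrow> (LINT x|lborel. partial i \<theta> x)"
  proof (rule integral_dominated_convergence[where w = "\<lambda>x. B * indicator (cball 0 (R + 1)) x"])
    show "AE x in lborel. (\<lambda>n. ?q n x) \<longlonglongrightarrow> partial i \<theta> x"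
    proof (rule AE_I2)
      fix x
      have "((\<lambda>s. (\<theta> (s *\<^sub>R ?e + x) - \<theta> x) / s) \<longlongrightarrow> partial i \<theta> x) (at 0)"
        using line[of x 0] by (simp add: has_field_derivative_iff)
      moreover have "filterlim ?h (at 0) sequentially"
        using LIMSEQ_inverse_real_of_nat by (auto simp: filterlim_at)
      ultimately show "(\<lambda>n. ?q n x) \<longlonglongrightarrow> partial i \<theta> x"
        by (rule filterlim_compose)
    qed
    show "integrable lborel (\<lambda>x::real^3. B * indicator (cball 0 (R + 1)) x)"
      using emeasure_lborel_cball_finite by (intro integrable_mult_right integrable_real_indicator) auto
    show "AE x in lborel. norm (?q n x) \<le> B * indicator (cball 0 (R + 1)) x" for n
      by (rule AE_I2) (simp only: real_norm_def bound)
  qed measurable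
  moreover have "(LINT x|lborel. ?q n x) = 0" for n
  proof -
    have int: "integrable lborel \<theta>" by (rule integrable_lborel_test_fun[OF assms(2)])
    have "integrable (distr lborel borel ((+) (?h n *\<^sub>R ?e))) \<theta>"
      using int by (simp add: lborel_distr_plus)
    then have "integrable lborel (\<lambda>x. \<theta> (?h n *\<^sub>R ?e + x))"
      by (subst (asm) integrable_distr_eq) auto
    then show ?thesis
      using int by (simp add: integral_lborel_translation)
  qed
  ultimately have "(LINT x|lborel. partial i \<theta> x) = 0"
    by (simp add: LIMSEQ_const_iff)
  then show ?thesis
    using integral_test_fun_lborel[OF assms(1) test_fun_partial[OF assms(2)]] by simp
qed

subsection \<open>Symmetry of second derivatives\<close>

text \<open>The second difference is symmetric in \<open>i\<close> and \<open>j\<close>, whereas the mean value theorem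
  expresses it by the second derivative in either order.\<close>

lemma second_difference_mean_value:
  assumes "smooth f" "h > 0"
  obtains s t where "0 < s" "s < h" "0 < t" "t < h"
    "f (x + h *\<^sub>R axis i 1 + h *\<^sub>R axis j 1) - f (x + h *\<^sub>R axis i 1) - f (x + h *\<^sub>R axis j 1) + f x
      = h * h * partial j (partial i f) (x + s *\<^sub>R axis i 1 + t *\<^sub>R axis j 1)"
proof -
  note D = partial_along_line[OF smooth_differentiable[OF assms(1)]]
  note D2 = partial_along_line[OF smooth_differentiable[OF smooth_partial[OF assms(1)]]]
  define g where "g s = f (x + h *\<^sub>R axis j 1 + s *\<^sub>R axis i 1) - f (x + s *\<^sub>R axis i 1)" for s
  define g' where "g' s = partial i f (x + h *\<^sub>R axis j 1 + s *\<^sub>R axis i 1) - partial i f (x + s *\<^sub>R axis i 1)" for s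
  have "(g has_real_derivative g' s) (at s)" for s
    unfolding g_def g'_def by (intro DERIV_diff D)
  then obtain s where s: "0 < s" "s < h" "g h - g 0 = (h - 0) * g' s"
    using MVT2[OF assms(2), of g g'] by blast
  obtain t where t: "0 < t" "t < h"
    "partial i f (x + s *\<^sub>R axis i 1 + h *\<^sub>R axis j 1) - partial i f (x + s *\<^sub>R axis i 1 + 0 *\<^sub>R axis j 1)
      = (h - 0) * partial j (partial i f) (x + s *\<^sub>R axis i 1 + t *\<^sub>R axis j 1)"
    using MVT2[OF assms(2), of "\<lambda>t. partial i f (x + s *\<^sub>R axis i 1 + t *\<^sub>R axis j 1)"
        "\<lambda>t. partial j (partial i f) (x + s *\<^sub>R axis i 1 + t *\<^sub>R axis j 1)"] D2 by blast
  show ?thesis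
    using that[OF s(1,2) t(1,2)] s(3) t(3) by (simp add: g_def g'_def algebra_simps)
qed

lemma partial_commute:
  assumes "smooth f" shows "partial i (partial j f) x = partial j (partial i f) x"
proof -
  let ?h = "\<lambda>n. inverse (real (Suc n))"
  have "\<forall>n. \<exists>s t s' t'. (0 < s \<and> s < ?h n \<and> 0 < t \<and> t < ?h n \<and> 0 < s' \<and> s' < ?h n \<and> 0 < t' \<and> t' < ?h n) \<and>
      partial j (partial i f) (x + s *\<^sub>R axis i 1 + t *\<^sub>R axis j 1) =
      partial i (partial j f) (x + s' *\<^sub>R axis j 1 + t' *\<^sub>R axis i 1)"
  proof
    fix n
    have h: "?h n > 0" by simp
    obtain s t where 1: "0 < s" "s < ?h n" "0 < t" "t < ?h n"
      "f (x + ?h n *\<^sub>R axis i 1 + ?h n *\<^sub>R axis j 1) - f (x + ?h n *\<^sub>R axis i 1) - f (x + ?h n *\<^sub>R axis j 1) + f x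
      = ?h n * ?h n * partial j (partial i f) (x + s *\<^sub>R axis i 1 + t *\<^sub>R axis j 1)"
      using second_difference_mean_value[OF assms h] by blast
    obtain s' t' where 2: "0 < s'" "s' < ?h n" "0 < t'" "t' < ?h n"
      "f (x + ?h n *\<^sub>R axis j 1 + ?h n *\<^sub>R axis i 1) - f (x + ?h n *\<^sub>R axis j 1) - f (x + ?h n *\<^sub>R axis i 1) + f x
      = ?h n * ?h n * partial i (partial j f) (x + s' *\<^sub>R axis j 1 + t' *\<^sub>R axis i 1)"
      using second_difference_mean_value[OF assms h] by blast
    have "?h n * ?h n * partial j (partial i f) (x + s *\<^sub>R axis i 1 + t *\<^sub>R axis j 1) =
      ?h n * ?h n * partial i (partial j f) (x + s' *\<^sub>R axis j 1 + t' *\<^sub>R axis i 1)"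
      unfolding 1(5)[symmetric] 2(5)[symmetric] by (simp add: add_ac)
    then have "partial j (partial i f) (x + s *\<^sub>R axis i 1 + t *\<^sub>R axis j 1) =
      partial i (partial j f) (x + s' *\<^sub>R axis j 1 + t' *\<^sub>R axis i 1)"
      using h by simp
    then show "\<exists>s t s' t'. (0 < s \<and> s < ?h n \<and> 0 < t \<and> t < ?h n \<and> 0 < s' \<and> s' < ?h n \<and> 0 < t' \<and> t' < ?h n) \<and>
      partial j (partial i f) (x + s *\<^sub>R axis i 1 + t *\<^sub>R axis j 1) =
      partial i (partial j f) (x + s' *\<^sub>R axis j 1 + t' *\<^sub>R axis i 1)"
      using 1(1-4) 2(1-4) by blast
  qed
  then obtain s t s' t' where st: "\<And>n. 0 < s n \<and> s n < ?h n \<and> 0 < t n \<and> t n < ?h n \<and>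
      0 < s' n \<and> s' n < ?h n \<and> 0 < t' n \<and> t' n < ?h n"
    and eq: "\<And>n. partial j (partial i f) (x + s n *\<^sub>R axis i 1 + t n *\<^sub>R axis j 1) =
      partial i (partial j f) (x + s' n *\<^sub>R axis j 1 + t' n *\<^sub>R axis i 1)"
    by metis
  have lim: "a \<longlonglongrightarrow> 0" if "\<And>n. 0 < a n \<and> a n < ?h n" for a :: "nat \<Rightarrow> real"
    by (rule tendsto_sandwich[OF _ _ tendsto_const LIMSEQ_inverse_real_of_nat])
       (use that in \<open>auto intro!: always_eventually less_imp_le\<close>)
  have "s \<longlonglongrightarrow> 0" "t \<longlonglongrightarrow> 0" "s' \<longlonglongrightarrow> 0" "t' \<longlonglongrightarrow> 0" using lim st by blast+
  then have "(\<lambda>n. x + s n *\<^sub>R axis i 1 + t n *\<^sub>R axis j 1) \<longlonglongrightarrow> x + 0 *\<^sub>R axis i 1 + 0 *\<^sub>R axis j 1"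
    and "(\<lambda>n. x + s' n *\<^sub>R axis j 1 + t' n *\<^sub>R axis i 1) \<longlonglongrightarrow> x + 0 *\<^sub>R axis j 1 + 0 *\<^sub>R axis i 1"
    by (auto intro!: tendsto_intros simp del: scaleR_zero_left)
  then have "(\<lambda>n. partial j (partial i f) (x + s n *\<^sub>R axis i 1 + t n *\<^sub>R axis j 1)) \<longlonglongrightarrow> partial j (partial i f) x"
    "(\<lambda>n. partial i (partial j f) (x + s' n *\<^sub>R axis j 1 + t' n *\<^sub>R axis i 1)) \<longlonglongrightarrow> partial i (partial j f) x"
    using isCont_tendsto_compose[OF smooth_isCont[OF smooth_partial[OF smooth_partial[OF assms]]]] by fastforce+
  then show ?thesis
    unfolding eq using LIMSEQ_unique by blast
qed

lemma classical_div_curl: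
  assumes "\<And>i. smooth (\<lambda>x. \<theta> x $ i)" shows "classical_div (classical_curl \<theta>) x = 0"
proof -
  have d: "partial i (\<lambda>y. partial j (\<lambda>z. \<theta> z $ k) y - partial l (\<lambda>z. \<theta> z $ m) y) x =
      partial i (partial j (\<lambda>z. \<theta> z $ k)) x - partial i (partial l (\<lambda>z. \<theta> z $ m)) x" for i j k l m
    by (intro partial_diff smooth_differentiable smooth_partial assms)
  show ?thesis
    unfolding classical_div_def classical_curl_def sum_3 vector_3 d
    using partial_commute[OF assms, of 1 2 3 x] partial_commute[OF assms, of 1 3 2 x]
      partial_commute[OF assms, of 2 3 1 x] by simp
qed

section \<open>Functions with vanishing distributional gradient\<close>

lemma continuous_coord:
  assumes "smooth (\<lambda>x. h (x $ j))" shows "isCont h t"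
proof -
  have "continuous_on UNIV (\<lambda>t. (\<lambda>x. h (x $ j)) (t *\<^sub>R axis j 1 :: real^3))"
    by (rule continuous_on_compose2[OF smooth_continuous_on[OF assms, of UNIV]])
       (auto intro!: continuous_intros)
  then have "continuous_on UNIV h" by (simp add: axis_def)
  then show ?thesis by (simp add: continuous_on_eq_continuous_at)
qed

lemma antiderivative_exists:
  fixes h :: "real \<Rightarrow> real"
  assumes "\<And>t. isCont h t"
  obtains H where "\<And>t. (H has_real_derivative h t) (at t)"
  using einterval_antiderivative[of "-\<infinity>" "\<infinity>" h] assms
  by (auto simp: has_real_derivative_iff_has_vector_derivative)

lemma antiderivative_support:
  fixes H h :: "real \<Rightarrow> real"
  assumes H: "\<And>t. (H has_real_derivative h t) (at t)" and h: "\<And>t. t \<notin> {l..u} \<Longrightarrow> h t = 0"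
    and "H l = 0" "H u = 0" and t: "t \<notin> {l..u}"
  shows "H t = 0"
proof (cases "t < l")
  case True
  then obtain z where "t < z" "z < l" "H l - H t = (l - t) * h z"
    using MVT2[of t l H h] H by auto
  then show ?thesis using h[of z] assms(3) by simp
next
  case False
  with t have "u < t" by simp
  then obtain z where "u < z" "z < t" "H t - H u = (t - u) * h z"
    using MVT2[of u t H h] H by auto
  then show ?thesis using h[of z] assms(4) by simp
qed

lemma factor_prod_upd: "factor_prod (h(i := k)) x = k (x $ i) * (\<Prod>j\<in>UNIV - {i}. h j (x $ j))"
proof -
  have "factor_prod (h(i := k)) x = (h(i := k)) i (x $ i) * (\<Prod>j\<in>UNIV - {i}. (h(i := k)) j (x $ j))"
    unfolding factor_prod_def by (rule prod.remove) auto
  then show ?thesis by simp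
qed

text \<open>If \<open>X' = h i - k * \<eta> i\<close>, where \<open>k\<close> is the quotient of the integrals of \<open>h i\<close> and
  \<open>\<eta> i\<close>, then \<open>X\<close> has compact support, and replacing the \<open>i\<close>-th factor by \<open>X\<close> gives a test
  function. Its \<open>i\<close>-th partial derivative is the difference of the two products compared here.
  The integrals are written as increments of antiderivatives.\<close>

lemma factor_exchange:
  assumes h: "box_factors a b h" "box_factors a b \<eta>" and sub: "cbox a b \<subseteq> \<Omega>"
    and H: "\<And>t. (H has_real_derivative h i t) (at t)" and E: "\<And>t. (E has_real_derivative \<eta> i t) (at t)"
    and E0: "E (b $ i) \<noteq> E (a $ i)"
    and int: "integrable (lebesgue_on \<Omega>) g"
    and weak: "\<And>\<theta> i. test_fun \<Omega> \<theta> \<Longrightarrow> (LINT x|lebesgue_on \<Omega>. g x * partial i \<theta> x) = 0"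
  shows "(LINT x|lebesgue_on \<Omega>. g x * factor_prod h x) =
    (H (b $ i) - H (a $ i)) / (E (b $ i) - E (a $ i)) *
    (LINT x|lebesgue_on \<Omega>. g x * factor_prod (h(i := \<eta> i)) x)"
proof -
  let ?k = "(H (b $ i) - H (a $ i)) / (E (b $ i) - E (a $ i))"
  define X where "X t = (H t - H (a $ i)) - ?k * (E t - E (a $ i))" for t
  define d where "d t = h i t - ?k * \<eta> i t" for t
  have "((\<lambda>t. (H t - H (a $ i)) - k * (E t - E (a $ i))) has_real_derivative h i t - k * \<eta> i t) (at t)" for t k
    by (auto intro!: derivative_eq_intros H E)
  then have X: "(X has_real_derivative d t) (at t)" for t
    unfolding X_def d_def by blast
  have d0: "d t = 0" if "t \<notin> {a $ i..b $ i}" for t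
    using h that unfolding d_def box_factors_def by auto
  have smoothd: "smooth (\<lambda>x. d (x $ i))"
    unfolding d_def using h unfolding box_factors_def
    by (intro smooth_diff smooth_mult smooth_const) auto
  have X0: "X t = 0" if "t \<notin> {a $ i..b $ i}" for t
  proof (rule antiderivative_support[OF X d0 _ _ that])
    have "E (b $ i) - E (a $ i) \<noteq> 0" using E0 by simp
    then show "X (b $ i) = 0" unfolding X_def by simp
    show "X (a $ i) = 0" unfolding X_def by simp
  qed
  have bX: "box_factors a b (h(i := X))"
    unfolding box_factors_def
  proof (intro allI conjI impI)
    show "smooth (\<lambda>x. (h(i := X)) j (x $ j))" for j
      using h smooth_coord_antiderivative[OF X smoothd] unfolding box_factors_def
      by (cases "j = i") auto
    show "(h(i := X)) j t = 0" if "t \<notin> {a $ j..b $ j}" for j t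
      using h X0 that unfolding box_factors_def by (cases "j = i") auto
  qed
  define R where "R x = (\<Prod>j\<in>UNIV - {i}. h j (x $ j))" for x
  have fac: "factor_prod h x = h i (x $ i) * R x" for x
    using factor_prod_upd[of h i "h i" x] unfolding R_def by simp
  have smoothR: "smooth R"
    unfolding R_def using h unfolding box_factors_def by (intro smooth_prod) auto
  have partR: "partial i R x = 0" for x
  proof (rule partial_eq_0)
    show "R (x + s *\<^sub>R axis i 1) = R x" for x s
      unfolding R_def by (rule prod.cong) (auto simp: axis_def)
  qed (rule smooth_differentiable[OF smoothR])
  have "partial i (factor_prod (h(i := X))) x = d (x $ i) * R x" for x
  proof -
    have "factor_prod (h(i := X)) = (\<lambda>x. X (x $ i) * R x)"
      unfolding factor_prod_upd R_def by simp
    then have "partial i (factor_prod (h(i := X))) x =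
        X (x $ i) * partial i R x + partial i (\<lambda>x. X (x $ i)) x * R x"
      using partial_mult[of "\<lambda>x. X (x $ i)" x R i] has_derivative_coord[OF X] smoothR
      by (auto intro: differentiableI smooth_differentiable)
    then show ?thesis by (simp add: partR partial_coord[OF X])
  qed
  then have "0 = (LINT x|lebesgue_on \<Omega>. g x * (d (x $ i) * R x))"
    using weak[OF test_fun_factor_prod[OF bX sub], of i] by simp
  also have "\<dots> = (LINT x|lebesgue_on \<Omega>. g x * factor_prod h x - ?k * (g x * factor_prod (h(i := \<eta> i)) x))"
  proof (rule Bochner_Integration.integral_cong)
    show "g x * (d (x $ i) * R x) = g x * factor_prod h x - ?k * (g x * factor_prod (h(i := \<eta> i)) x)" for x
      unfolding fac factor_prod_upd R_def[symmetric] d_def by (simp only: left_diff_distrib right_diff_distrib mult_ac)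
  qed simp
  also have "\<dots> = (LINT x|lebesgue_on \<Omega>. g x * factor_prod h x) -
      ?k * (LINT x|lebesgue_on \<Omega>. g x * factor_prod (h(i := \<eta> i)) x)"
  proof -
    have "box_factors a b (h(i := \<eta> i))"
      using h unfolding box_factors_def by auto
    then show ?thesis
      using integrable_mult_test_fun[OF int test_fun_factor_prod[OF _ sub]] h(1) by simp
  qed
  finally show ?thesis by simp
qed

text \<open>By exchanging factors, the integral of \<open>g\<close> against any product test function is proportional
  to its integral against one fixed product, with a factor that is the same for \<open>g\<close> and for the
  function 1. So a suitable multiple of 1 has the same integrals as \<open>g\<close>.\<close>

lemma weakly_constant_on_box:
  assumes "open \<Omega>" and int: "integrable (lebesgue_on \<Omega>) g" and sub: "cbox a b \<subseteq> \<Omega>"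
    and weak: "\<And>\<theta> i. test_fun \<Omega> \<theta> \<Longrightarrow> (LINT x|lebesgue_on \<Omega>. g x * partial i \<theta> x) = 0"
    and int1: "integrable (lebesgue_on \<Omega>) (\<lambda>x. 1::real)"
  obtains c where "AE x in lebesgue. x \<in> box a b \<longrightarrow> g x = c"
proof (cases "box a b = {}")
  case True
  then show ?thesis using that[of 0] by simp
next
  case False
  then have ab: "a $ j < b $ j" for j
    by (metis ex_in_conv less_trans mem_box_cart(1))
  define \<eta> where "\<eta> j = bump (a $ j) (b $ j) 0" for j
  have \<eta>: "box_factors a b \<eta>"
    unfolding \<eta>_def by (rule box_factors_bump) auto
  have cont: "isCont (h j) t" if "box_factors a b h" for h j t
    using that continuous_coord[of "h j" j t] unfolding box_factors_def by blast
  have "\<exists>E. \<forall>t. (E has_real_derivative \<eta> j t) (at t)" for j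
    using antiderivative_exists[OF cont[OF \<eta>]] by metis
  then obtain E where E: "\<And>j t. (E j has_real_derivative \<eta> j t) (at t)" by metis
  have E0: "E j (b $ j) \<noteq> E j (a $ j)" for j
  proof -
    obtain z where "a $ j < z" "z < b $ j" "E j (b $ j) - E j (a $ j) = (b $ j - a $ j) * \<eta> j z"
      using MVT2[OF ab[of j], of "E j" "\<eta> j"] E by auto
    moreover from this have "\<eta> j z \<noteq> 0" unfolding \<eta>_def bump_eq_0_iff by simp
    ultimately show ?thesis using ab[of j] by auto
  qed
  define J where "J f h = (LINT x|lebesgue_on \<Omega>. f x * factor_prod h x)" for f h
  \<comment> \<open>Exchanging the three factors one after the other reduces every product to the product of
    the \<open>\<eta> j\<close>, with a coefficient that does not depend on the function integrated.\<close>
  have M: "\<exists>M. \<forall>f. integrable (lebesgue_on \<Omega>) f \<and>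
      (\<forall>\<theta> i. test_fun \<Omega> \<theta> \<longrightarrow> (LINT x|lebesgue_on \<Omega>. f x * partial i \<theta> x) = 0) \<longrightarrow> J f h = M * J f \<eta>"
    if h: "box_factors a b h" for h
  proof -
    have "\<exists>H. \<forall>t. (H has_real_derivative h j t) (at t)" for j
      using antiderivative_exists[OF cont[OF h]] by metis
    then obtain H where H: "\<And>j t. (H j has_real_derivative h j t) (at t)" by metis
    define m where "m i = (H i (b $ i) - H i (a $ i)) / (E i (b $ i) - E i (a $ i))" for i
    have "J f h = (m 1 * (m 2 * m 3)) * J f \<eta>"
      if f: "integrable (lebesgue_on \<Omega>) f"
        "\<And>\<theta> i. test_fun \<Omega> \<theta> \<Longrightarrow> (LINT x|lebesgue_on \<Omega>. f x * partial i \<theta> x) = 0" for f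
    proof -
      have step: "J f h' = m i * J f (h'(i := \<eta> i))" if "box_factors a b h'" "h' i = h i" for h' i
        unfolding J_def m_def
        by (rule factor_exchange[OF that(1) \<eta> sub _ E E0 f]) (simp add: that(2) H)
      let ?h1 = "h(1 := \<eta> 1)" let ?h2 = "?h1(2 := \<eta> 2)"
      have b1: "box_factors a b ?h1" using h \<eta> unfolding box_factors_def by auto
      have b2: "box_factors a b ?h2" using b1 \<eta> unfolding box_factors_def by auto
      have "?h2(3 := \<eta> 3) = \<eta>" using exhaust_3 by (auto simp: fun_eq_iff)
      then show ?thesis
        using step[OF h, of 1] step[OF b1, of 2] step[OF b2, of 3] by simp
    qed
    then show ?thesis by blast
  qed
  have J1: "J (\<lambda>x. 1) \<eta> \<noteq> 0"
  proof
    assume "J (\<lambda>x. 1) \<eta> = 0"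
    then have "(LINT x|lebesgue_on \<Omega>. factor_prod \<eta> x) = 0" by (simp add: J_def)
    moreover have "0 \<le> factor_prod \<eta> x" for x
      unfolding factor_prod_def \<eta>_def by (intro prod_nonneg) (simp add: bump_bounds)
    moreover have "integrable (lebesgue_on \<Omega>) (factor_prod \<eta>)"
      using integrable_mult_test_fun[OF int1 test_fun_factor_prod[OF \<eta> sub]] by simp
    ultimately have "AE x in lebesgue_on \<Omega>. factor_prod \<eta> x = 0"
      by (simp add: integral_nonneg_eq_0_iff_AE)
    then have "AE x in lebesgue. x \<in> \<Omega> \<longrightarrow> factor_prod \<eta> x = 0"
      using \<open>open \<Omega>\<close> by (simp add: AE_restrict_space_iff)
    then have "AE x in lebesgue. x \<notin> box a b"
    proof eventually_elim
      fix x assume *: "x \<in> \<Omega> \<longrightarrow> factor_prod \<eta> x = 0"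
      show "x \<notin> box a b"
      proof
        assume x: "x \<in> box a b"
        then have "\<eta> j (x $ j) \<noteq> 0" for j
          unfolding \<eta>_def bump_eq_0_iff by (simp add: mem_box_cart)
        then have "factor_prod \<eta> x \<noteq> 0" by (simp add: factor_prod_def)
        moreover have "x \<in> \<Omega>" using x sub box_subset_cbox by blast
        ultimately show False using * by blast
      qed
    qed
    then have "negligible (box a b)"
      by (simp add: negligible_iff_null_sets AE_iff_null_sets)
    then show False
      using open_not_negligible[OF open_box False] by blast
  qed
  define c where "c = J g \<eta> / J (\<lambda>x. 1) \<eta>"
  have intc: "integrable (lebesgue_on \<Omega>) (\<lambda>x. g x - c)"
    using int integrable_mult_right[OF int1, of c] by simp
  have "AE x in lebesgue. x \<in> box a b \<longrightarrow> g x - c = 0"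
  proof (rule fundamental_lemma_box[OF \<open>open \<Omega>\<close> intc sub])
    fix h assume h: "box_factors a b h"
    obtain M where M: "J g h = M * J g \<eta>" "J (\<lambda>x. 1) h = M * J (\<lambda>x. 1) \<eta>"
      using M[OF h] int weak int1 integral_partial_test_fun[of \<Omega>] \<open>open \<Omega>\<close> by fastforce
    have "(LINT x|lebesgue_on \<Omega>. (g x - c) * factor_prod h x) = J g h - c * J (\<lambda>x. 1) h"
      using integrable_mult_test_fun[OF int test_fun_factor_prod[OF h sub]]
        integrable_mult_test_fun[OF int1 test_fun_factor_prod[OF h sub]]
      by (simp add: J_def algebra_simps)
    also have "\<dots> = 0" using M J1 by (simp add: c_def)
    finally show "(LINT x|lebesgue_on \<Omega>. (g x - c) * factor_prod h x) = 0" .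
  qed
  then show ?thesis using that[of c] by simp
qed

text \<open>The constants on overlapping boxes agree, because a nonempty open set is not negligible;
  so they form a locally constant function on \<open>\<Omega>\<close>.\<close>

theorem weakly_constant:
  assumes \<Omega>: "open \<Omega>" "connected \<Omega>" and int: "integrable (lebesgue_on \<Omega>) g"
    and weak: "\<And>\<theta> i. test_fun \<Omega> \<theta> \<Longrightarrow> (LINT x|lebesgue_on \<Omega>. g x * partial i \<theta> x) = 0"
    and int1: "integrable (lebesgue_on \<Omega>) (\<lambda>x. 1::real)"
  obtains c where "AE x in lebesgue_on \<Omega>. g x = c"
proof -
  define Q where "Q a b c \<longleftrightarrow> (AE y in lebesgue. y \<in> box a b \<longrightarrow> g y = c)" for a b c
  define P where "P x c \<longleftrightarrow> (\<exists>a b. x \<in> box a b \<and> Q a b c)" for x c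
  have uniq: "c = c'" if "P x c" "P x c'" for x c c'
  proof (rule ccontr)
    assume "c \<noteq> c'"
    obtain a b where B: "x \<in> box a b" "Q a b c"
      using \<open>P x c\<close> unfolding P_def by blast
    obtain a' b' where B': "x \<in> box a' b'" "Q a' b' c'"
      using \<open>P x c'\<close> unfolding P_def by blast
    have "AE y in lebesgue. y \<notin> box a b \<inter> box a' b'"
      using B(2)[unfolded Q_def] B'(2)[unfolded Q_def] by eventually_elim (use \<open>c \<noteq> c'\<close> in auto)
    then have "negligible (box a b \<inter> box a' b')"
      by (simp add: negligible_iff_null_sets AE_iff_null_sets)
    moreover have "open (box a b \<inter> box a' b')" "box a b \<inter> box a' b' \<noteq> {}" using B(1) B'(1) by auto
    ultimately show False using open_not_negligible by blast
  qed
  define f where "f x = (SOME c. P x c)" for x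
  have f: "f x = c" if "P x c" for x c
    unfolding f_def using that uniq by (metis someI)
  have fbox: "AE y in lebesgue. y \<in> box a b \<longrightarrow> g y = f y" "\<And>x y. x \<in> box a b \<Longrightarrow> y \<in> box a b \<Longrightarrow> f x = f y"
    if "cbox a b \<subseteq> \<Omega>" for a b
  proof -
    obtain c where c: "AE x in lebesgue. x \<in> box a b \<longrightarrow> g x = c"
      using weakly_constant_on_box[OF \<Omega>(1) int \<open>cbox a b \<subseteq> \<Omega>\<close> weak int1] by blast
    then have *: "f y = c" if "y \<in> box a b" for y
      using that c unfolding Q_def[symmetric] by (intro f) (auto simp: P_def)
    show "AE y in lebesgue. y \<in> box a b \<longrightarrow> g y = f y"
      using c by eventually_elim (simp add: *)
    show "f x = f y" if "x \<in> box a b" "y \<in> box a b" for x y using that * by simp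
  qed
  have ae: "AE y in lebesgue_on \<Omega>. g y = f y"
    by (rule AE_if_AE_boxes[OF \<Omega>(1) fbox(1)])
  show ?thesis
  proof (cases "\<Omega> = {}")
    case True
    then show ?thesis using that[of 0] by (simp add: AE_restrict_space_iff)
  next
    case False
    then obtain z where "z \<in> \<Omega>" by blast
    have "f x = f z" if "x \<in> \<Omega>" for x
    proof (rule connected_local_const[OF \<Omega>(2) that \<open>z \<in> \<Omega>\<close>], rule ballI)
      fix u assume "u \<in> \<Omega>"
      then obtain a b where ab: "cbox a b \<subseteq> \<Omega>" "u \<in> box a b"
        using open_contains_cbox[OF \<Omega>(1)] by metis
      have "\<forall>\<^sub>F v in at u within \<Omega>. v \<in> box a b"
        using ab(2) open_box by (intro eventually_at_topological[THEN iffD2]) blast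
      then show "\<forall>\<^sub>F v in at u within \<Omega>. f u = f v"
        by eventually_elim (use fbox(2)[OF ab(1)] ab(2) in blast)
    qed
    then have "AE y in lebesgue_on \<Omega>. y \<in> \<Omega> \<longrightarrow> f y = f z" by simp
    moreover have "AE y in lebesgue_on \<Omega>. y \<in> \<Omega>"
      by (rule AE_I2) (simp)
    ultimately have "AE y in lebesgue_on \<Omega>. g y = f z"
      using ae by eventually_elim simp
    then show ?thesis using that by blast
  qed
qed

section \<open>Weak derivatives\<close>

locale bounded_open_set =
  fixes \<Omega> :: "(real^3) set"
  assumes open_set: "open \<Omega>" and bounded_set: "bounded \<Omega>"
begin

lemma lebesgue_set: "\<Omega> \<in> sets lebesgue"
  using open_set by simp

lemma integrable_constant: "integrable (lebesgue_on \<Omega>) (\<lambda>x. c::real)"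
proof -
  have "\<Omega> \<in> lmeasurable" using open_set bounded_set lmeasurable_open by blast
  then have "finite_measure (lebesgue_on \<Omega>)"
    by (simp add: finite_measure_lebesgue_on)
  then show ?thesis by (rule finite_measure.integrable_const)
qed

lemma L2_const: "(\<lambda>x. c::real) \<in> L2 \<Omega>"
  by (simp add: L2_def integrable_constant)

lemma L2_integrable: "(f :: scalar_field) \<in> L2 \<Omega> \<Longrightarrow> integrable (lebesgue_on \<Omega>) f"
  using L2_inner_integrable[OF _ L2_const[of 1]] by simp

lemma L2_test_fun: assumes "test_fun \<Omega> \<theta>" shows "\<theta> \<in> L2 \<Omega>"
proof -
  have "integrable (lebesgue_on \<Omega>) (\<lambda>x. 1 * (\<theta> x * \<theta> x))"
    by (intro integrable_mult_test_fun integrable_constant test_fun_mult test_fun_smooth[OF assms] assms)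
  then show ?thesis
    unfolding L2_def using measurable_lebesgue_on_smooth[OF test_fun_smooth[OF assms]]
    by (simp add: power2_eq_square)
qed

lemma L2_component:
  fixes f :: vector_field
  assumes "f \<in> L2 \<Omega>" shows "(\<lambda>x. f x $ i) \<in> L2 \<Omega>"
proof (rule L2_bound)
  show "(\<lambda>x. f x $ i) \<in> borel_measurable (lebesgue_on \<Omega>)"
    using borel_measurable_inner[OF L2_measurable[OF assms] borel_measurable_const[of "axis i 1"]]
    by (simp add: inner_axis)
  show "integrable (lebesgue_on \<Omega>) (\<lambda>x. (norm (f x))\<^sup>2)" by (rule L2_norm_sq_integrable[OF assms])
  show "(norm (f x $ i))\<^sup>2 \<le> (norm (f x))\<^sup>2" for x
    by (rule power_mono[OF Finite_Cartesian_Product.norm_nth_le]) simp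
qed

lemma L2_vecI:
  fixes f :: vector_field
  assumes "\<And>i. (\<lambda>x. f x $ i) \<in> L2 \<Omega>" shows "f \<in> L2 \<Omega>"
proof (rule L2_bound)
  show "f \<in> borel_measurable (lebesgue_on \<Omega>)"
    unfolding borel_measurable_euclidean_space[of f]
    using L2_measurable[OF assms] by (auto simp: Basis_vec_def inner_axis)
  show "integrable (lebesgue_on \<Omega>) (\<lambda>x. \<Sum>i\<in>UNIV. (norm (f x $ i))\<^sup>2)"
    by (intro Bochner_Integration.integrable_sum L2_norm_sq_integrable assms)
  show "(norm (f x))\<^sup>2 \<le> (\<Sum>i\<in>UNIV. (norm (f x $ i))\<^sup>2)" for x
    unfolding power2_norm_eq_inner inner_vec_def by (rule order_refl)
qed

lemma l2_inner_components:
  fixes f g :: vector_field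
  assumes "f \<in> L2 \<Omega>" "g \<in> L2 \<Omega>"
  shows "l2_inner \<Omega> f g = (\<Sum>i\<in>UNIV. l2_inner \<Omega> (\<lambda>x. f x $ i) (\<lambda>x. g x $ i))"
  unfolding l2_inner_def inner_vec_def
  by (intro Bochner_Integration.integral_sum L2_inner_integrable L2_component assms)

lemma test_fieldD: "test_field \<Omega> \<theta> \<Longrightarrow> test_fun \<Omega> (\<lambda>x. \<theta> x $ i)"
  by (simp add: test_field_def)

lemma L2_test_field: "test_field \<Omega> \<theta> \<Longrightarrow> \<theta> \<in> L2 \<Omega>"
  by (intro L2_vecI L2_test_fun test_fieldD)

lemma test_fun_classical_div: "test_field \<Omega> \<theta> \<Longrightarrow> test_fun \<Omega> (classical_div \<theta>)"
  unfolding classical_div_def sum_3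
  by (intro test_fun_add test_fun_partial test_fieldD)

lemma test_field_classical_grad: "test_fun \<Omega> \<theta> \<Longrightarrow> test_field \<Omega> (classical_grad \<theta>)"
  unfolding test_field_def classical_grad_def by (simp add: test_fun_partial)

lemma test_field_classical_curl: "test_field \<Omega> \<theta> \<Longrightarrow> test_field \<Omega> (classical_curl \<theta>)"
  unfolding test_field_def forall_3 classical_curl_def vector_3
  by (intro conjI test_fun_diff test_fun_partial) auto

lemma test_field_axis:
  assumes "test_fun \<Omega> \<theta>" shows "test_field \<Omega> (\<lambda>x. axis j (\<theta> x))"
  unfolding test_field_def
proof
  show "test_fun \<Omega> (\<lambda>x. axis j (\<theta> x) $ i)" for i
    using assms test_fun_zero by (cases "i = j") (simp_all add: axis_def)
qed

lemma classical_div_axis: "classical_div (\<lambda>x. axis j (\<theta> x)) = partial j \<theta>"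
proof
  fix x
  have "partial i (\<lambda>y. axis j (\<theta> y) $ i) x = (if i = j then partial j \<theta> x else 0)" for i
    by (simp add: axis_def)
  then show "classical_div (\<lambda>x. axis j (\<theta> x)) x = partial j \<theta> x"
    by (simp add: classical_div_def)
qed

lemma l2_inner_axis: "l2_inner \<Omega> f (\<lambda>x. axis j (\<theta> x)) = l2_inner \<Omega> (\<lambda>x. f x $ j) \<theta>"
  by (simp add: l2_inner_def inner_axis)

subsection \<open>Uniqueness\<close>

lemma AE_zero_if_orthogonal_test_funs:
  assumes "(g :: scalar_field) \<in> L2 \<Omega>" "\<And>\<theta>. test_fun \<Omega> \<theta> \<Longrightarrow> l2_inner \<Omega> g \<theta> = 0"
  shows "AE x in lebesgue_on \<Omega>. g x = 0"
  using fundamental_lemma[OF open_set L2_integrable[OF assms(1)]] assms(2)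
  by (simp add: l2_inner_def)

lemma AE_zero_if_orthogonal_test_fields:
  assumes "(g :: vector_field) \<in> L2 \<Omega>" "\<And>\<theta>. test_field \<Omega> \<theta> \<Longrightarrow> l2_inner \<Omega> g \<theta> = 0"
  shows "AE x in lebesgue_on \<Omega>. g x = 0"
proof -
  have "AE x in lebesgue_on \<Omega>. g x $ i = 0" for i
    using assms(2)[OF test_field_axis] unfolding l2_inner_axis
    by (intro AE_zero_if_orthogonal_test_funs L2_component assms(1)) auto
  then have "AE x in lebesgue_on \<Omega>. \<forall>i. g x $ i = 0"
    by (simp add: AE_all_countable)
  then show ?thesis by (simp add: vec_eq_iff)
qed

lemma AE_eq_if_test_fields_agree:
  fixes g g' :: vector_field
  assumes "g \<in> L2 \<Omega>" "g' \<in> L2 \<Omega>" "\<And>\<theta>. test_field \<Omega> \<theta> \<Longrightarrow> l2_inner \<Omega> g \<theta> = l2_inner \<Omega> g' \<theta>"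
  shows "AE x in lebesgue_on \<Omega>. g x = g' x"
proof -
  have "AE x in lebesgue_on \<Omega>. g x - g' x = 0"
    using assms by (intro AE_zero_if_orthogonal_test_fields)
      (auto simp: l2_inner_diff_left L2_test_field intro: L2_diff)
  then show ?thesis by simp
qed

lemma is_weak_grad_weak_grad: "is_weak_grad \<Omega> v g \<Longrightarrow> is_weak_grad \<Omega> v (weak_grad \<Omega> v)"
  unfolding weak_grad_def using someI[of "is_weak_grad \<Omega> _"] by blast

lemma weak_grad_AE:
  assumes "is_weak_grad \<Omega> v g" shows "AE x in lebesgue_on \<Omega>. weak_grad \<Omega> v x = g x"
  using is_weak_grad_weak_grad[OF assms] assms
  by (intro AE_eq_if_test_fields_agree) (auto simp: is_weak_grad_def)

lemma is_weak_curl_weak_curl: "is_weak_curl \<Omega> q g \<Longrightarrow> is_weak_curl \<Omega> q (weak_curl \<Omega> q)"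
  unfolding weak_curl_def using someI[of "is_weak_curl \<Omega> _"] by blast

lemma weak_curl_AE:
  assumes "is_weak_curl \<Omega> q g" shows "AE x in lebesgue_on \<Omega>. weak_curl \<Omega> q x = g x"
  using is_weak_curl_weak_curl[OF assms] assms
  by (intro AE_eq_if_test_fields_agree) (auto simp: is_weak_curl_def)

lemma is_weak_div_weak_div: "is_weak_div \<Omega> q g \<Longrightarrow> is_weak_div \<Omega> q (weak_div \<Omega> q)"
  unfolding weak_div_def using someI[of "is_weak_div \<Omega> _"] by blast

lemma weak_div_AE:
  assumes "is_weak_div \<Omega> q g" shows "AE x in lebesgue_on \<Omega>. weak_div \<Omega> q x = g x"
proof -
  have "AE x in lebesgue_on \<Omega>. weak_div \<Omega> q x - g x = 0"
    using is_weak_div_weak_div[OF assms] assms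
    by (intro AE_zero_if_orthogonal_test_funs)
      (auto simp: is_weak_div_def l2_inner_diff_left L2_test_fun intro: L2_diff)
  then show ?thesis by simp
qed

lemma weak_grad_L2: "is_weak_grad \<Omega> v g \<Longrightarrow> weak_grad \<Omega> v \<in> L2 \<Omega>"
  using is_weak_grad_weak_grad by (simp add: is_weak_grad_def)

lemma l2_inner_right_cong_AE:
  assumes "g \<in> L2 \<Omega>" "g' \<in> L2 \<Omega>" "f \<in> L2 \<Omega>" "AE x in lebesgue_on \<Omega>. g x = g' x"
  shows "l2_inner \<Omega> f g = l2_inner \<Omega> f g'"
  unfolding l2_inner_commute[of \<Omega> f] by (rule l2_inner_cong_AE[OF assms])

lemma l2_inner_weak_grad:
  "is_weak_grad \<Omega> v g \<Longrightarrow> f \<in> L2 \<Omega> \<Longrightarrow> l2_inner \<Omega> f (weak_grad \<Omega> v) = l2_inner \<Omega> f g"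
  using weak_grad_L2[of v g]
  by (intro l2_inner_right_cong_AE weak_grad_AE) (auto simp: is_weak_grad_def)

lemma l2_inner_weak_div:
  "is_weak_div \<Omega> q g \<Longrightarrow> f \<in> L2 \<Omega> \<Longrightarrow> l2_inner \<Omega> f (weak_div \<Omega> q) = l2_inner \<Omega> f g"
  using is_weak_div_weak_div[of q g]
  by (intro l2_inner_right_cong_AE weak_div_AE) (auto simp: is_weak_div_def)

lemma l2_inner_weak_curl:
  "is_weak_curl \<Omega> q g \<Longrightarrow> f \<in> L2 \<Omega> \<Longrightarrow> l2_inner \<Omega> f (weak_curl \<Omega> q) = l2_inner \<Omega> f g"
  using is_weak_curl_weak_curl[of q g]
  by (intro l2_inner_right_cong_AE weak_curl_AE) (auto simp: is_weak_curl_def)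

subsection \<open>Weak gradients\<close>

lemma is_weak_grad_component:
  assumes "is_weak_grad \<Omega> v g" "test_fun \<Omega> \<theta>"
  shows "l2_inner \<Omega> (\<lambda>x. g x $ j) \<theta> = - l2_inner \<Omega> v (partial j \<theta>)"
proof -
  have "l2_inner \<Omega> g (\<lambda>x. axis j (\<theta> x)) = - l2_inner \<Omega> v (classical_div (\<lambda>x. axis j (\<theta> x)))"
    using assms(1) test_field_axis[OF assms(2), of j] by (simp only: is_weak_grad_def)
  then show ?thesis by (simp only: l2_inner_axis classical_div_axis)
qed

lemma l2_inner_classical_div:
  assumes "v \<in> L2 \<Omega>" "test_field \<Omega> \<theta>"
  shows "l2_inner \<Omega> v (classical_div \<theta>) = (\<Sum>i\<in>UNIV. l2_inner \<Omega> v (partial i (\<lambda>x. \<theta> x $ i)))"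
  unfolding l2_inner_def classical_div_def inner_sum_right
  by (intro Bochner_Integration.integral_sum L2_inner_integrable assms(1) L2_test_fun test_fun_partial test_fieldD assms(2))

lemma test_fun_integration_by_parts:
  assumes "test_fun \<Omega> \<theta>" "test_fun \<Omega> \<psi>"
  shows "l2_inner \<Omega> (partial i \<theta>) \<psi> = - l2_inner \<Omega> \<theta> (partial i \<psi>)"
proof -
  have p: "partial i (\<lambda>x. \<theta> x * \<psi> x) x = \<theta> x * partial i \<psi> x + partial i \<theta> x * \<psi> x" for x
    by (intro partial_mult smooth_differentiable test_fun_smooth[OF assms(1)] test_fun_smooth[OF assms(2)])
  have "0 = (LINT x|lebesgue_on \<Omega>. partial i (\<lambda>x. \<theta> x * \<psi> x) x)"
    by (rule integral_partial_test_fun[symmetric, OF lebesgue_set test_fun_mult[OF test_fun_smooth[OF assms(1)] assms(2)]])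
  also have "\<dots> = l2_inner \<Omega> \<theta> (partial i \<psi>) + l2_inner \<Omega> (partial i \<theta>) \<psi>"
    unfolding p l2_inner_def inner_real_def
    using L2_inner_integrable[OF L2_test_fun[OF assms(1)] L2_test_fun[OF test_fun_partial[OF assms(2), of i]]]
      L2_inner_integrable[OF L2_test_fun[OF test_fun_partial[OF assms(1), of i]] L2_test_fun[OF assms(2)]]
    by (intro Bochner_Integration.integral_add) auto
  finally show ?thesis by simp
qed

lemma is_weak_grad_test_fun:
  assumes "test_fun \<Omega> \<theta>" shows "is_weak_grad \<Omega> \<theta> (classical_grad \<theta>)"
  unfolding is_weak_grad_def
proof (intro conjI allI impI)
  show "classical_grad \<theta> \<in> L2 \<Omega>" by (intro L2_test_field test_field_classical_grad assms)
  fix \<psi> assume \<psi>: "test_field \<Omega> \<psi>"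
  show "l2_inner \<Omega> (classical_grad \<theta>) \<psi> = - l2_inner \<Omega> \<theta> (classical_div \<psi>)"
    using test_fun_integration_by_parts[OF assms test_fieldD[OF \<psi>]]
    by (simp add: l2_inner_components L2_test_field test_field_classical_grad assms \<psi>
        l2_inner_classical_div L2_test_fun classical_grad_def sum_negf)
qed

lemma is_weak_grad_zero: "is_weak_grad \<Omega> (\<lambda>x. 0) (\<lambda>x. 0)"
  by (simp add: is_weak_grad_def L2_zero)

lemma is_weak_grad_add:
  assumes "v \<in> L2 \<Omega>" "w \<in> L2 \<Omega>" "is_weak_grad \<Omega> v g" "is_weak_grad \<Omega> w h"
  shows "is_weak_grad \<Omega> (\<lambda>x. v x + w x) (\<lambda>x. g x + h x)"
  using assms unfolding is_weak_grad_def
  by (auto simp: l2_inner_add_left L2_test_field L2_test_fun test_fun_classical_div intro: L2_add)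

lemma is_weak_grad_scaleR:
  "is_weak_grad \<Omega> v g \<Longrightarrow> is_weak_grad \<Omega> (\<lambda>x. c * v x) (\<lambda>x. c *\<^sub>R g x)"
  using l2_inner_scaleR_left[of \<Omega> c v] unfolding is_weak_grad_def
  by (auto simp: l2_inner_scaleR_left intro: L2_scaleR)

lemma is_weak_grad_diff:
  assumes "v \<in> L2 \<Omega>" "w \<in> L2 \<Omega>" "is_weak_grad \<Omega> v g" "is_weak_grad \<Omega> w h"
  shows "is_weak_grad \<Omega> (\<lambda>x. v x - w x) (\<lambda>x. g x - h x)"
  using assms unfolding is_weak_grad_def
  by (auto simp: l2_inner_diff_left L2_test_field L2_test_fun test_fun_classical_div intro: L2_diff)

text \<open>The weak form of \<open>curl grad = 0\<close> is the classical identity \<open>div curl = 0\<close> for test fields.\<close>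

lemma is_weak_curl_grad:
  assumes "v \<in> L2 \<Omega>" "is_weak_grad \<Omega> v g" shows "is_weak_curl \<Omega> g (\<lambda>x. 0)"
  unfolding is_weak_curl_def
proof (intro conjI allI impI)
  fix \<theta> assume \<theta>: "test_field \<Omega> \<theta>"
  have "classical_div (classical_curl \<theta>) = (\<lambda>x. 0)"
    using classical_div_curl[OF test_fun_smooth[OF test_fieldD[OF \<theta>]]] by auto
  then show "l2_inner \<Omega> (\<lambda>x. 0) \<theta> = l2_inner \<Omega> g (classical_curl \<theta>)"
    using assms(2) test_field_classical_curl[OF \<theta>] by (simp add: is_weak_grad_def)
qed (rule L2_zero)

lemma weak_grad_zero_imp_constant:
  assumes "connected \<Omega>" "r \<in> L2 \<Omega>" "is_weak_grad \<Omega> r (\<lambda>x. 0)"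
  obtains c where "AE x in lebesgue_on \<Omega>. r x = c"
proof (rule weakly_constant[OF open_set assms(1) L2_integrable[OF assms(2)]])
  show "(LINT x|lebesgue_on \<Omega>. r x * partial i \<theta> x) = 0" if "test_fun \<Omega> \<theta>" for \<theta> i
    using is_weak_grad_component[OF assms(3) that, of i] by (simp add: l2_inner_def)
qed (auto intro: integrable_constant that)

subsection \<open>The curl of a field that vanishes on the boundary\<close>

text \<open>The curl as a linear function of the Jacobian: \<open>G k\<close> plays the role of the gradient of the
  \<open>k\<close>-th component. It allows weak and classical gradients to be treated alike.\<close>

definition curl_of_rows :: "(3 \<Rightarrow> vector_field) \<Rightarrow> vector_field" where
  "curl_of_rows G x = vector [G 3 x $ 2 - G 2 x $ 3, G 1 x $ 3 - G 3 x $ 1, G 2 x $ 1 - G 1 x $ 2]"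

lemma classical_curl_rows: "classical_curl \<theta> = curl_of_rows (\<lambda>k. classical_grad (\<lambda>x. \<theta> x $ k))"
  by (auto simp: fun_eq_iff classical_curl_def curl_of_rows_def classical_grad_def)

lemma L2_curl_of_rows:
  assumes "\<And>k. G k \<in> L2 \<Omega>" shows "curl_of_rows G \<in> L2 \<Omega>"
proof (rule L2_vecI)
  fix i :: 3
  have "\<forall>i. (\<lambda>x. curl_of_rows G x $ i) \<in> L2 \<Omega>"
    unfolding forall_3 curl_of_rows_def vector_3 by (intro conjI L2_diff L2_component assms)
  then show "(\<lambda>x. curl_of_rows G x $ i) \<in> L2 \<Omega>" by blast
qed

lemma l2_inner_curl_of_rows:
  assumes "\<And>k. G k \<in> L2 \<Omega>" "q \<in> L2 \<Omega>"
  defines "T \<equiv> \<lambda>k j l. l2_inner \<Omega> (\<lambda>x. G k x $ j) (\<lambda>x. q x $ l)"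
  shows "l2_inner \<Omega> (curl_of_rows G) q = (T 3 2 1 - T 2 3 1) + (T 1 3 2 - T 3 1 2) + (T 2 1 3 - T 1 2 3)"
  unfolding l2_inner_components[OF L2_curl_of_rows[OF assms(1)] assms(2)] sum_3 curl_of_rows_def vector_3 T_def
  by (simp add: l2_inner_diff_left L2_component assms)

lemma is_weak_curl_rows:
  assumes \<phi>: "\<And>k. (\<lambda>x. \<phi> x $ k) \<in> L2 \<Omega>" and G: "\<And>k. is_weak_grad \<Omega> (\<lambda>x. \<phi> x $ k) (G k)"
  shows "is_weak_curl \<Omega> \<phi> (curl_of_rows G)"
  unfolding is_weak_curl_def
proof (intro conjI allI impI)
  have GL: "G k \<in> L2 \<Omega>" for k using G by (simp add: is_weak_grad_def)
  show "curl_of_rows G \<in> L2 \<Omega>" by (rule L2_curl_of_rows[OF GL])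
  fix \<theta> assume \<theta>: "test_field \<Omega> \<theta>"
  have p: "partial j (\<lambda>x. \<theta> x $ k) \<in> L2 \<Omega>" for j k
    by (intro L2_test_fun test_fun_partial test_fieldD \<theta>)
  show "l2_inner \<Omega> (curl_of_rows G) \<theta> = l2_inner \<Omega> \<phi> (classical_curl \<theta>)"
    unfolding l2_inner_curl_of_rows[OF GL L2_test_field[OF \<theta>]]
      l2_inner_components[OF L2_vecI[OF \<phi>] L2_test_field[OF test_field_classical_curl[OF \<theta>]]] sum_3
    by (simp add: is_weak_grad_component[OF G test_fieldD[OF \<theta>]] classical_curl_def
        l2_inner_diff_right \<phi> p)
qed

text \<open>For test fields this is the weak form of \<open>curl grad = 0\<close>; in general \<open>\<phi>\<close> is
  approximated by test fields, the inner product being continuous in the Jacobian of \<open>\<phi>\<close>.\<close>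

lemma curl_orthogonal_grad:
  assumes \<phi>: "\<phi> \<in> H10_vec \<Omega>" and z: "z \<in> L2 \<Omega>" "is_weak_grad \<Omega> z q"
  shows "l2_inner \<Omega> (weak_curl \<Omega> \<phi>) q = 0"
proof -
  let ?\<phi> = "\<lambda>k x. \<phi> x $ k"
  have qL: "q \<in> L2 \<Omega>" using z(2) by (simp add: is_weak_grad_def)
  have \<phi>k: "?\<phi> k \<in> L2 \<Omega>" "\<exists>g. is_weak_grad \<Omega> (?\<phi> k) g"
    "\<forall>e>0. \<exists>\<theta>. test_fun \<Omega> \<theta> \<and> H1_norm \<Omega> (\<lambda>x. \<phi> x $ k - \<theta> x) < e" for k
    using \<phi> unfolding H10_vec_def H10_def H1_def by auto
  define G where "G k = weak_grad \<Omega> (?\<phi> k)" for k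
  have G: "is_weak_grad \<Omega> (?\<phi> k) (G k)" for k
    unfolding G_def using \<phi>k(2) is_weak_grad_weak_grad by blast
  then have GL: "G k \<in> L2 \<Omega>" for k by (simp add: is_weak_grad_def)
  have curl: "l2_inner \<Omega> (weak_curl \<Omega> \<phi>) q = l2_inner \<Omega> (curl_of_rows G) q"
    using l2_inner_weak_curl[OF is_weak_curl_rows[OF \<phi>k(1) G] qL] by (simp add: l2_inner_commute)
  have "\<forall>k n. \<exists>\<theta>. test_fun \<Omega> \<theta> \<and> H1_norm \<Omega> (\<lambda>x. \<phi> x $ k - \<theta> x) < inverse (real (Suc n))"
    using \<phi>k(3) by simp
  then obtain \<Theta> where \<Theta>: "\<And>k n. test_fun \<Omega> (\<Theta> k n)"
    "\<And>k n. H1_norm \<Omega> (\<lambda>x. \<phi> x $ k - \<Theta> k n x) < inverse (real (Suc n))" by metis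
  define D where "D n k x = G k x - classical_grad (\<Theta> k n) x" for n k x
  have cL: "classical_grad (\<Theta> k n) \<in> L2 \<Omega>" for k n
    by (intro L2_test_field test_field_classical_grad \<Theta>)
  have DL: "D n k \<in> L2 \<Omega>" for n k unfolding D_def by (intro L2_diff GL cL)
  have D0: "(\<lambda>n. l2_inner \<Omega> (D n k) (D n k)) \<longlonglongrightarrow> 0" for k
  proof (rule tendsto_sandwich[OF _ _ tendsto_const])
    have wg: "is_weak_grad \<Omega> (\<lambda>x. \<phi> x $ k - \<Theta> k n x) (D n k)" for n
      unfolding D_def by (intro is_weak_grad_diff \<phi>k G L2_test_fun \<Theta> is_weak_grad_test_fun)
    have "l2_inner \<Omega> (D n k) (D n k) \<le> (inverse (real (Suc n)))\<^sup>2" for n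
    proof -
      let ?v = "\<lambda>x. \<phi> x $ k - \<Theta> k n x"
      have "l2_inner \<Omega> (weak_grad \<Omega> ?v) (weak_grad \<Omega> ?v) = l2_inner \<Omega> (D n k) (D n k)"
        using l2_inner_weak_grad[OF wg weak_grad_L2[OF wg]] l2_inner_weak_grad[OF wg DL]
        by (simp add: l2_inner_commute)
      moreover have "l2_inner \<Omega> ?v ?v \<ge> 0" by (rule l2_inner_nonneg)
      ultimately have "sqrt (l2_inner \<Omega> (D n k) (D n k)) \<le> H1_norm \<Omega> ?v"
        unfolding H1_norm_def by simp
      then have "sqrt (l2_inner \<Omega> (D n k) (D n k)) \<le> inverse (real (Suc n))"
        using \<Theta>(2)[of k n] by simp
      then show ?thesis by (rule sqrt_le_D)
    qed
    then show "\<forall>\<^sub>F n in sequentially. l2_inner \<Omega> (D n k) (D n k) \<le> (inverse (real (Suc n)))\<^sup>2"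
      by simp
    show "(\<lambda>n. (inverse (real (Suc n)))\<^sup>2) \<longlonglongrightarrow> 0"
      using tendsto_power[OF LIMSEQ_inverse_real_of_nat, of 2] by simp
  qed (simp add: l2_inner_nonneg)
  have Dj0: "(\<lambda>n. l2_inner \<Omega> (\<lambda>x. D n k x $ j) (\<lambda>x. q x $ l)) \<longlonglongrightarrow> 0" for k j l
  proof -
    have "(\<lambda>x. axis j (q x $ l)) \<in> L2 \<Omega>"
    proof (rule L2_vecI)
      show "(\<lambda>x. axis j (q x $ l) $ i) \<in> L2 \<Omega>" for i
        by (cases "i = j") (simp_all add: axis_def L2_component qL L2_zero)
    qed
    from l2_inner_tendsto_zero[OF DL this D0] show ?thesis unfolding l2_inner_axis .
  qed
  have "(\<lambda>n. l2_inner \<Omega> (curl_of_rows (D n)) q) \<longlonglongrightarrow> (0 - 0) + (0 - 0) + (0 - 0)"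
    unfolding l2_inner_curl_of_rows[OF DL qL] by (intro tendsto_intros Dj0)
  moreover have "l2_inner \<Omega> (curl_of_rows (D n)) q = l2_inner \<Omega> (curl_of_rows G) q" for n
  proof -
    define \<theta> where "\<theta> x = (\<chi> k. \<Theta> k n x)" for x
    have \<theta>: "test_field \<Omega> \<theta>" unfolding test_field_def \<theta>_def by (simp add: \<Theta>)
    have "l2_inner \<Omega> q (classical_curl \<theta>) = 0"
      using is_weak_curl_grad[OF z] \<theta> by (simp add: is_weak_curl_def)
    moreover have "classical_curl \<theta> = curl_of_rows (\<lambda>k. classical_grad (\<Theta> k n))"
      by (simp add: classical_curl_rows \<theta>_def)
    ultimately have "l2_inner \<Omega> (curl_of_rows (\<lambda>k. classical_grad (\<Theta> k n))) q = 0"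
      by (simp add: l2_inner_commute)
    then show ?thesis
      using l2_inner_curl_of_rows[of "D n" q, OF DL qL] l2_inner_curl_of_rows[OF GL qL]
        l2_inner_curl_of_rows[of "\<lambda>k. classical_grad (\<Theta> k n)" q, OF cL qL]
      unfolding D_def by (simp add: l2_inner_diff_left L2_component GL cL qL)
  qed
  ultimately show ?thesis
    unfolding curl by (simp add: LIMSEQ_const_iff)
qed

end

section \<open>The Neumann problem\<close>

lemma L2_fst: assumes "(f :: real^3 \<Rightarrow> real \<times> (real^3)) \<in> L2 \<Omega>" shows "(\<lambda>x. fst (f x)) \<in> L2 \<Omega>"
proof (rule L2_bound[OF _ L2_norm_sq_integrable[OF assms]])
  show "(\<lambda>x. fst (f x)) \<in> borel_measurable (lebesgue_on \<Omega>)"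
    using L2_measurable[OF assms] by (rule measurable_compose) (simp add: borel_measurable_continuous_onI continuous_on_fst)
  show "(norm (fst (f x)))\<^sup>2 \<le> (norm (f x))\<^sup>2" for x
    by (simp add: norm_prod_def)
qed

lemma L2_snd: assumes "(f :: real^3 \<Rightarrow> real \<times> (real^3)) \<in> L2 \<Omega>" shows "(\<lambda>x. snd (f x)) \<in> L2 \<Omega>"
proof (rule L2_bound[OF _ L2_norm_sq_integrable[OF assms]])
  show "(\<lambda>x. snd (f x)) \<in> borel_measurable (lebesgue_on \<Omega>)"
    using L2_measurable[OF assms] by (rule measurable_compose) (simp add: borel_measurable_continuous_onI continuous_on_snd)
  show "(norm (snd (f x)))\<^sup>2 \<le> (norm (f x))\<^sup>2" for x
    by (simp add: norm_prod_def)
qed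

lemma L2_Pair:
  assumes "(v :: scalar_field) \<in> L2 \<Omega>" "(g :: vector_field) \<in> L2 \<Omega>" shows "(\<lambda>x. (v x, g x)) \<in> L2 \<Omega>"
proof (rule L2_bound)
  show "(\<lambda>x. (v x, g x)) \<in> borel_measurable (lebesgue_on \<Omega>)"
    using assms by (intro borel_measurable_Pair L2_measurable)
  show "integrable (lebesgue_on \<Omega>) (\<lambda>x. (norm (v x))\<^sup>2 + (norm (g x))\<^sup>2)"
    using assms by (intro Bochner_Integration.integrable_add L2_norm_sq_integrable)
  show "(norm (v x, g x))\<^sup>2 \<le> (norm (v x))\<^sup>2 + (norm (g x))\<^sup>2" for x
    by (simp add: norm_Pair)
qed

lemma l2_inner_Pair:
  fixes F G :: "real^3 \<Rightarrow> real \<times> (real^3)"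
  assumes "F \<in> L2 \<Omega>" "G \<in> L2 \<Omega>"
  shows "l2_inner \<Omega> F G = l2_inner \<Omega> (\<lambda>x. fst (F x)) (\<lambda>x. fst (G x)) + l2_inner \<Omega> (\<lambda>x. snd (F x)) (\<lambda>x. snd (G x))"
  unfolding l2_inner_def inner_prod_def
  using L2_inner_integrable[OF L2_fst[OF assms(1)] L2_fst[OF assms(2)]]
    L2_inner_integrable[OF L2_snd[OF assms(1)] L2_snd[OF assms(2)]]
  by (intro Bochner_Integration.integral_add)

context bounded_open_set
begin

text \<open>Pairing a function with its gradient makes the \<open>H\<^sup>1\<close> inner product an instance of the \<open>L\<^sup>2\<close>
  inner product of fields with values in \<open>\<real> \<times> \<real>\<^sup>3\<close>.\<close>

definition grad_graph :: "(real^3 \<Rightarrow> real \<times> (real^3)) set" where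
  "grad_graph = {F. F \<in> L2 \<Omega> \<and> is_weak_grad \<Omega> (\<lambda>x. fst (F x)) (\<lambda>x. snd (F x))}"

lemma grad_graph_closed:
  assumes f: "\<And>n. f n \<in> grad_graph" and g: "g \<in> L2 \<Omega>"
    and lim: "(\<lambda>n. l2_inner \<Omega> (\<lambda>x. f n x - g x) (\<lambda>x. f n x - g x)) \<longlonglongrightarrow> 0"
  shows "g \<in> grad_graph"
proof -
  have fL: "f n \<in> L2 \<Omega>" for n using f unfolding grad_graph_def by blast
  have split: "l2_inner \<Omega> (\<lambda>x. f n x - g x) (\<lambda>x. f n x - g x) =
      l2_inner \<Omega> (\<lambda>x. fst (f n x) - fst (g x)) (\<lambda>x. fst (f n x) - fst (g x)) +
      l2_inner \<Omega> (\<lambda>x. snd (f n x) - snd (g x)) (\<lambda>x. snd (f n x) - snd (g x))" for n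
    using l2_inner_Pair[OF L2_diff[OF fL g] L2_diff[OF fL g]] by simp
  have l1: "(\<lambda>n. l2_inner \<Omega> (\<lambda>x. fst (f n x) - fst (g x)) (\<lambda>x. fst (f n x) - fst (g x))) \<longlonglongrightarrow> 0"
    by (rule tendsto_sandwich[OF _ _ tendsto_const lim]) (simp_all add: split l2_inner_nonneg)
  have l2: "(\<lambda>n. l2_inner \<Omega> (\<lambda>x. snd (f n x) - snd (g x)) (\<lambda>x. snd (f n x) - snd (g x))) \<longlonglongrightarrow> 0"
    by (rule tendsto_sandwich[OF _ _ tendsto_const lim]) (simp_all add: split l2_inner_nonneg)
  have "l2_inner \<Omega> (\<lambda>x. snd (g x)) \<theta> = - l2_inner \<Omega> (\<lambda>x. fst (g x)) (classical_div \<theta>)"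
    if \<theta>: "test_field \<Omega> \<theta>" for \<theta>
  proof (rule LIMSEQ_unique)
    show "(\<lambda>n. l2_inner \<Omega> (\<lambda>x. snd (f n x)) \<theta>) \<longlonglongrightarrow> l2_inner \<Omega> (\<lambda>x. snd (g x)) \<theta>"
      by (rule l2_inner_tendsto[OF L2_snd[OF fL] L2_snd[OF g] L2_test_field[OF \<theta>] l2])
    have "(\<lambda>n. - l2_inner \<Omega> (\<lambda>x. fst (f n x)) (classical_div \<theta>)) \<longlonglongrightarrow> - l2_inner \<Omega> (\<lambda>x. fst (g x)) (classical_div \<theta>)"
      by (intro tendsto_minus l2_inner_tendsto[OF L2_fst[OF fL] L2_fst[OF g] L2_test_fun[OF test_fun_classical_div[OF \<theta>]] l1])
    moreover have "l2_inner \<Omega> (\<lambda>x. snd (f n x)) \<theta> = - l2_inner \<Omega> (\<lambda>x. fst (f n x)) (classical_div \<theta>)" for n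
      using f[of n] \<theta> unfolding grad_graph_def is_weak_grad_def by blast
    ultimately show "(\<lambda>n. l2_inner \<Omega> (\<lambda>x. snd (f n x)) \<theta>) \<longlonglongrightarrow> - l2_inner \<Omega> (\<lambda>x. fst (g x)) (classical_div \<theta>)"
      by simp
  qed
  then show ?thesis
    unfolding grad_graph_def is_weak_grad_def using g L2_snd[OF g] by blast
qed

text \<open>The weak form of \<open>- div grad z + z = r\<close> with vanishing normal derivative states precisely that
  \<open>(r, 0) - (z, grad z)\<close> is orthogonal to the graph of the gradient.\<close>

theorem neumann_problem:
  assumes r: "r \<in> L2 \<Omega>"
  obtains z q where "z \<in> L2 \<Omega>" "is_weak_grad \<Omega> z q"
    "\<And>v g. v \<in> L2 \<Omega> \<Longrightarrow> is_weak_grad \<Omega> v g \<Longrightarrow> l2_inner \<Omega> q g + l2_inner \<Omega> z v = l2_inner \<Omega> r v"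
proof -
  have F: "(\<lambda>x. (r x, 0 :: real^3)) \<in> L2 \<Omega>" by (rule L2_Pair[OF r L2_zero])
  obtain P where P: "P \<in> grad_graph"
    and orth: "\<And>v. v \<in> grad_graph \<Longrightarrow> l2_inner \<Omega> (\<lambda>x. (r x, 0) - P x) v = 0"
  proof (rule L2_projection[of grad_graph \<Omega> "\<lambda>x. (r x, 0)"])
    show "grad_graph \<subseteq> L2 \<Omega>" unfolding grad_graph_def by blast
    show "grad_graph \<noteq> {}"
      using is_weak_grad_zero L2_zero[of \<Omega>] unfolding grad_graph_def by force
    show "(\<lambda>x. v x + w x) \<in> grad_graph" if "v \<in> grad_graph" "w \<in> grad_graph" for v w
      using that is_weak_grad_add[OF L2_fst L2_fst, of v w] unfolding grad_graph_def
      by (auto simp: fst_add snd_add intro: L2_add)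
    show "(\<lambda>x. c *\<^sub>R v x) \<in> grad_graph" if "v \<in> grad_graph" for c v
      using that is_weak_grad_scaleR[of "\<lambda>x. fst (v x)" "\<lambda>x. snd (v x)" c] unfolding grad_graph_def
      by (auto simp: fst_scaleR snd_scaleR intro: L2_scaleR)
  qed (use F grad_graph_closed that in \<open>blast+\<close>)
  have PL: "P \<in> L2 \<Omega>" and Pg: "is_weak_grad \<Omega> (\<lambda>x. fst (P x)) (\<lambda>x. snd (P x))"
    using P unfolding grad_graph_def by auto
  show ?thesis
  proof (rule that[OF L2_fst[OF PL] Pg])
    fix v g assume v: "v \<in> L2 \<Omega>" "is_weak_grad \<Omega> v g"
    then have g: "g \<in> L2 \<Omega>" by (simp add: is_weak_grad_def)
    have vg: "(\<lambda>x. (v x, g x)) \<in> L2 \<Omega>" by (rule L2_Pair[OF v(1) g])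
    then have "(\<lambda>x. (v x, g x)) \<in> grad_graph" using v(2) by (simp add: grad_graph_def)
    then have "0 = l2_inner \<Omega> (\<lambda>x. (r x, 0) - P x) (\<lambda>x. (v x, g x))" by (simp add: orth)
    also have "\<dots> = l2_inner \<Omega> (\<lambda>x. r x - fst (P x)) v + l2_inner \<Omega> (\<lambda>x. - snd (P x)) g"
      using l2_inner_Pair[OF L2_diff[OF F PL] vg] by simp
    also have "\<dots> = l2_inner \<Omega> r v - l2_inner \<Omega> (\<lambda>x. fst (P x)) v - l2_inner \<Omega> (\<lambda>x. snd (P x)) g"
      by (simp add: l2_inner_diff_left r L2_fst PL v(1) l2_inner_uminus_left)
    finally show "l2_inner \<Omega> (\<lambda>x. snd (P x)) g + l2_inner \<Omega> (\<lambda>x. fst (P x)) v = l2_inner \<Omega> r v"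
      by simp
  qed
qed

text \<open>The weak equation, tested with test functions, identifies the divergence of \<open>q\<close>; tested with all
  of \<open>H\<^sup>1\<close>, it says that the normal trace vanishes. Being a gradient, \<open>q\<close> has zero curl, so
  it lies in \<open>Q\<close> also when \<open>\<epsilon> = 0\<close>.\<close>

lemma neumann_field:
  assumes r: "r \<in> L2 \<Omega>" and z: "z \<in> L2 \<Omega>" and q: "is_weak_grad \<Omega> z q"
    and weak: "\<And>v g. v \<in> L2 \<Omega> \<Longrightarrow> is_weak_grad \<Omega> v g \<Longrightarrow> l2_inner \<Omega> q g + l2_inner \<Omega> z v = l2_inner \<Omega> r v"
  shows "is_weak_div \<Omega> q (\<lambda>x. z x - r x)" "q \<in> Q_space \<Omega> \<epsilon>"
proof -
  have qL: "q \<in> L2 \<Omega>" using q by (simp add: is_weak_grad_def)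
  show div: "is_weak_div \<Omega> q (\<lambda>x. z x - r x)"
    unfolding is_weak_div_def
  proof (intro conjI allI impI)
    show "l2_inner \<Omega> (\<lambda>x. z x - r x) \<theta> = - l2_inner \<Omega> q (classical_grad \<theta>)" if "test_fun \<Omega> \<theta>" for \<theta>
      using weak[OF L2_test_fun[OF that] is_weak_grad_test_fun[OF that]]
      by (simp add: l2_inner_diff_left z r L2_test_fun[OF that])
  qed (rule L2_diff[OF z r])
  have "normal_trace \<Omega> q v = 0" if "v \<in> H1 \<Omega>" for v
  proof -
    obtain g where v: "v \<in> L2 \<Omega>" and g: "is_weak_grad \<Omega> v g" using \<open>v \<in> H1 \<Omega>\<close> unfolding H1_def by blast
    have "l2_inner \<Omega> (weak_div \<Omega> q) v = l2_inner \<Omega> (\<lambda>x. z x - r x) v"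
      unfolding l2_inner_commute[of \<Omega> _ v] by (rule l2_inner_weak_div[OF div v])
    then have "l2_inner \<Omega> (weak_div \<Omega> q) v = l2_inner \<Omega> z v - l2_inner \<Omega> r v"
      by (simp add: l2_inner_diff_left z r v)
    moreover have "l2_inner \<Omega> q (weak_grad \<Omega> v) = l2_inner \<Omega> q g" by (rule l2_inner_weak_grad[OF g qL])
    ultimately show ?thesis
      using weak[OF v g] unfolding normal_trace_def by simp
  qed
  then have "q \<in> H0div \<Omega>" unfolding H0div_def Hdiv_def using qL div by blast
  moreover have "q \<in> Hcurl \<Omega>" unfolding Hcurl_def using qL is_weak_curl_grad[OF z q] by blast
  ultimately show "q \<in> Q_space \<Omega> \<epsilon>" unfolding Q_space_def by simp
qed

lemma curl_pairing_grad:
  assumes "\<phi> \<in> V_space \<Omega> \<epsilon>" "z \<in> L2 \<Omega>" "is_weak_grad \<Omega> z q"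
  shows "curl_pairing \<Omega> \<epsilon> \<phi> q = 0"
proof (cases "\<epsilon> > 0")
  case True
  then show ?thesis
    using curl_orthogonal_grad assms unfolding curl_pairing_def V_space_def by simp
next
  case False
  then have "\<phi> \<in> L2 \<Omega>" using assms(1) by (simp add: V_space_def)
  then show ?thesis
    using False l2_inner_weak_curl[OF is_weak_curl_grad[OF assms(2,3)]] unfolding curl_pairing_def by simp
qed

subsection \<open>Vanishing of the multiplier\<close>

lemma multiplier_vanishes:
  assumes conn: "connected \<Omega>" and r: "r \<in> L2_mean_zero \<Omega>" and \<phi>: "\<phi> \<in> V_space \<Omega> \<epsilon>"
    and eq: "\<And>q. q \<in> Q_space \<Omega> \<epsilon> \<Longrightarrow> curl_pairing \<Omega> \<epsilon> \<phi> q + l2_inner \<Omega> r (weak_div \<Omega> q) = 0"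
  shows "AE x in lebesgue_on \<Omega>. r x = 0"
proof -
  have rL: "r \<in> L2 \<Omega>" and mean: "(LINT x|lebesgue_on \<Omega>. r x) = 0"
    using r by (auto simp: L2_mean_zero_def)
  obtain z q where z: "z \<in> L2 \<Omega>" and q: "is_weak_grad \<Omega> z q"
    and weak: "\<And>v g. v \<in> L2 \<Omega> \<Longrightarrow> is_weak_grad \<Omega> v g \<Longrightarrow> l2_inner \<Omega> q g + l2_inner \<Omega> z v = l2_inner \<Omega> r v"
    using neumann_problem[OF rL] by blast
  have qL: "q \<in> L2 \<Omega>" using q by (simp add: is_weak_grad_def)
  note div = neumann_field(1)[OF rL z q weak] and qQ = neumann_field(2)[OF rL z q weak]
  have "l2_inner \<Omega> r (weak_div \<Omega> q) = 0"
    using eq[OF qQ] curl_pairing_grad[OF \<phi> z q] by simp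
  then have rz: "l2_inner \<Omega> r z = l2_inner \<Omega> r r"
    using l2_inner_weak_div[OF div rL] by (simp add: l2_inner_diff_right z rL)
  \<comment> \<open>The weak equation tested with \<open>z\<close> says \<open>(q, q) + (z, z) = (r, z)\<close>.\<close>
  have "l2_inner \<Omega> (\<lambda>x. r x - z x) (\<lambda>x. r x - z x) + l2_inner \<Omega> q q = 0"
    using weak[OF z q] rz
    by (simp add: l2_inner_diff_left l2_inner_diff_right L2_diff z rL l2_inner_commute[of \<Omega> z r])
  then have "l2_inner \<Omega> (\<lambda>x. r x - z x) (\<lambda>x. r x - z x) = 0" "l2_inner \<Omega> q q = 0"
    using l2_inner_nonneg[of \<Omega> "\<lambda>x. r x - z x"] l2_inner_nonneg[of \<Omega> q] by linarith+
  then have rz0: "AE x in lebesgue_on \<Omega>. r x - z x = 0" and q0: "AE x in lebesgue_on \<Omega>. q x = 0"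
    using l2_inner_eq_0_iff[OF L2_diff[OF rL z]] l2_inner_eq_0_iff[OF qL] by blast+
  have "is_weak_grad \<Omega> r (\<lambda>x. 0)"
    unfolding is_weak_grad_def
  proof (intro conjI allI impI)
    fix \<theta> assume \<theta>: "test_field \<Omega> \<theta>"
    have "l2_inner \<Omega> r (classical_div \<theta>) = l2_inner \<Omega> z (classical_div \<theta>)"
      by (rule l2_inner_cong_AE[OF rL z L2_test_fun[OF test_fun_classical_div[OF \<theta>]]]) (use rz0 in simp)
    also have "\<dots> = - l2_inner \<Omega> q \<theta>" using q \<theta> by (simp add: is_weak_grad_def)
    also have "\<dots> = 0" using l2_inner_eq_0_AE[OF q0] by simp
    finally show "l2_inner \<Omega> (\<lambda>x. 0) \<theta> = - l2_inner \<Omega> r (classical_div \<theta>)" by simp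
  qed (rule L2_zero)
  then obtain c where c: "AE x in lebesgue_on \<Omega>. r x = c"
    using weak_grad_zero_imp_constant[OF conn rL] by blast
  have "l2_inner \<Omega> r r = l2_inner \<Omega> (\<lambda>x. c) r"
    by (rule l2_inner_cong_AE[OF rL L2_const rL c])
  also have "\<dots> = 0" using mean by (simp add: l2_inner_def)
  finally show ?thesis using l2_inner_eq_0_iff[OF rL] by blast
qed

text \<open>The zero field is the solution of the Neumann problem with zero data, hence is admissible; its weak
  divergence and curl are chosen representatives, which vanish only almost everywhere.\<close>

lemma B1_compare_zero_field:
  assumes "\<phi> \<in> V_space \<Omega> \<epsilon>" "r \<in> L2 \<Omega>"
  shows "(\<lambda>x. 0) \<in> Q_space \<Omega> \<epsilon>"
    and "B1 \<Omega> \<epsilon> \<phi> r p \<psi> s q - B1 \<Omega> \<epsilon> \<phi> r p \<psi> s (\<lambda>x. 0) =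
      curl_pairing \<Omega> \<epsilon> \<phi> q + l2_inner \<Omega> r (weak_div \<Omega> q)"
proof -
  have *: "l2_inner \<Omega> (\<lambda>x. 0::real^3) g + l2_inner \<Omega> (\<lambda>x. 0::real) v = l2_inner \<Omega> (\<lambda>x. 0) v" for v g
    by simp
  note N = neumann_field[OF L2_zero L2_zero is_weak_grad_zero *]
  show "(\<lambda>x. 0) \<in> Q_space \<Omega> \<epsilon>" by (rule N)
  have "l2_inner \<Omega> r (weak_div \<Omega> (\<lambda>x. 0)) = 0"
    using l2_inner_weak_div[OF N(1) assms(2)] by simp
  then show "B1 \<Omega> \<epsilon> \<phi> r p \<psi> s q - B1 \<Omega> \<epsilon> \<phi> r p \<psi> s (\<lambda>x. 0) =
      curl_pairing \<Omega> \<epsilon> \<phi> q + l2_inner \<Omega> r (weak_div \<Omega> q)"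
    using curl_pairing_grad[OF assms(1) L2_zero is_weak_grad_zero] by (simp add: B1_def)
qed

end

section \<open>Equivalence of the two problems\<close>

theorem mainTheorem7:
  fixes \<Omega> :: "(real^3) set" and \<epsilon>\<^sub>0 \<epsilon> :: real
    and f u w r :: scalar_field and \<phi> p :: vector_field
  assumes "polyhedral_domain \<Omega>"
    and "\<epsilon>\<^sub>0 > 0" and "0 \<le> \<epsilon>" and "\<epsilon> \<le> \<epsilon>\<^sub>0"
    and "f \<in> L2 \<Omega>"
    and "u \<in> H10 \<Omega>" and "w \<in> H10 \<Omega>"
    and "\<phi> \<in> V_space \<Omega> \<epsilon>" and "p \<in> Q_space \<Omega> \<epsilon>" and "r \<in> L2_mean_zero \<Omega>"
  shows "solves_A \<Omega> \<epsilon> f u w \<phi> p r \<longleftrightarrow> solves_B \<Omega> \<epsilon> f u w \<phi> p r"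
proof -
  interpret bounded_open_set \<Omega>
    using assms(1) by unfold_locales (auto simp: polyhedral_domain_def)
  have conn: "connected \<Omega>" using assms(1) by (simp add: polyhedral_domain_def)
  have rL: "r \<in> L2 \<Omega>" using assms(10) by (simp add: L2_mean_zero_def)
  note zeroQ = B1_compare_zero_field(1)[OF assms(8) rL] and diff = B1_compare_zero_field(2)[OF assms(8) rL]
  have "l2_inner \<Omega> r s = 0" if "solves_A \<Omega> \<epsilon> f u w \<phi> p r \<or> solves_B \<Omega> \<epsilon> f u w \<phi> p r" for s
  proof (rule l2_inner_eq_0_AE, rule multiplier_vanishes[OF conn assms(10,8)])
    fix q assume q: "q \<in> Q_space \<Omega> \<epsilon>"
    have "B1 \<Omega> \<epsilon> \<phi> r p \<phi> r q = B1 \<Omega> \<epsilon> \<phi> r p \<phi> r (\<lambda>x. 0)"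
      using that
    proof
      assume "solves_A \<Omega> \<epsilon> f u w \<phi> p r"
      then have "B1 \<Omega> \<epsilon> \<phi> r p \<phi> r q = l2_inner \<Omega> (weak_grad \<Omega> w) \<phi>" if "q \<in> Q_space \<Omega> \<epsilon>" for q
        unfolding solves_A_def using assms(6-8,10) that by blast
      then show ?thesis using q zeroQ by simp
    next
      assume "solves_B \<Omega> \<epsilon> f u w \<phi> p r"
      then have "B1 \<Omega> \<epsilon> \<phi> r p \<phi> r q + l2_inner \<Omega> r r = l2_inner \<Omega> (weak_grad \<Omega> w) \<phi>" if "q \<in> Q_space \<Omega> \<epsilon>" for q
        unfolding solves_B_def using assms(6-8,10) that by blast
      from this[OF q] this[OF zeroQ] show ?thesis by linarith
    qed
    then show "curl_pairing \<Omega> \<epsilon> \<phi> q + l2_inner \<Omega> r (weak_div \<Omega> q) = 0"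
      using diff by (metis diff_self)
  qed
  then show ?thesis
    unfolding solves_A_def solves_B_def by auto
qed

end
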